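(* Let $R$ be an associative (not necessarily commutative) ring with unity such that $|\mathrm{Max}(R)|\geq 2$, and let $n$ be a positive integer. If $\Gamma_2(R)\backslash J(R)$ is a complete $n$-partite graph, then $n=2$ or $n=q+1$, where $q$ is a power of a prime number. Moreover, $\frac{R}{J(R)}\cong M_2(\mathbb{F}_q)$ or $\frac{R}{J(R)}\cong D_1\times D_2$, where $D_1$ and $D_2$ are division rings.
   Context: $\mathrm{Max}(R)$ denotes the set of all maximal left ideals of $R$, and $J(R)$ denotes the Jacobson radical of $R$. $M_2(\mathbb{F}_q)$ is the ring of $2\times 2$ matrices over the field $\mathbb{F}_q$ with $q$ elements. The comaximal graph $\Gamma(R)$ is the graph whose vertices are the elements of $R$, where two distinct vertices $a$ and $b$ are adjacent if and only if $Ra+Rb=R$. $\Gamma_2(R)$ is the subgraph of $\Gamma(R)$ induced on the non-unit elements of $R$, and $\Gamma_2(R)\backslash J(R)$ is the subgraph of $\Gamma(R)$ induced on the non-unit elements of $R$ that do not belong to $J(R)$. An $n$-partite graph is one whose vertex set can be partitioned into $n$ (nonempty) subsets so that no edge has both ends in any one subset; a complete $n$-partite graph is one in which, moreover, each vertex is joined to every vertex that is not in the same subset. *)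

theory Defs
  imports
    "HOL-Algebra.Algebra"
    "HOL-Library.Disjoint_Sets"
    "HOL-Number_Theory.Prime_Powers"
    "Graph_Theory.Pair_Digraph"
    "Graph_Theory.Digraph_Component"
begin

text \<open>HOL-Algebra's \<open>ideal\<close> and \<open>maximalideal\<close> are two-sided, so the left versions are
  introduced here.\<close>

locale left_ideal = additive_subgroup I R + ring R for I and R (structure) +
  assumes l_closed: "\<lbrakk>a \<in> I; x \<in> carrier R\<rbrakk> \<Longrightarrow> x \<otimes> a \<in> I"

locale maximal_left_ideal = left_ideal +
  assumes notcarrier: "carrier R \<noteq> I"
    and I_maximal: "\<lbrakk>left_ideal J R; I \<subseteq> J; J \<subseteq> carrier R\<rbrakk> \<Longrightarrow> J = I \<or> J = carrier R"

definition max_left_ideals :: "('a, 'm) ring_scheme \<Rightarrow> 'a set set" where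
  "max_left_ideals R = {M. maximal_left_ideal M R}"

definition jacobson_radical :: "('a, 'm) ring_scheme \<Rightarrow> 'a set" where
  "jacobson_radical R = carrier R \<inter> \<Inter> (max_left_ideals R)"

locale division_ring = ring +
  assumes division_ring_Units: "Units R = carrier R - {\<zero>}"

text \<open>Matrices are extensional functions on the index set, so that equality of matrices is
  equality of entries.\<close>

definition matrix_ring :: "nat \<Rightarrow> ('a, 'm) ring_scheme \<Rightarrow> (nat \<times> nat \<Rightarrow> 'a) ring" where
  "matrix_ring n F =
    \<lparr>carrier = {..<n} \<times> {..<n} \<rightarrow>\<^sub>E carrier F,
     monoid.mult = (\<lambda>A B. \<lambda>(i, j) \<in> {..<n} \<times> {..<n}.
       \<Oplus>\<^bsub>F\<^esub> k \<in> {..<n}. A (i, k) \<otimes>\<^bsub>F\<^esub> B (k, j)),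
     monoid.one = (\<lambda>(i, j) \<in> {..<n} \<times> {..<n}. if i = j then \<one>\<^bsub>F\<^esub> else \<zero>\<^bsub>F\<^esub>),
     ring.zero = (\<lambda>(i, j) \<in> {..<n} \<times> {..<n}. \<zero>\<^bsub>F\<^esub>),
     ring.add = (\<lambda>A B. \<lambda>(i, j) \<in> {..<n} \<times> {..<n}. A (i, j) \<oplus>\<^bsub>F\<^esub> B (i, j))\<rparr>"

text \<open>Simple graphs are represented as symmetric loop-free digraphs, possibly infinite.
  \<open>PIdl\<^bsub>R\<^esub> a\<close> is by definition the set of all \<open>x \<otimes>\<^bsub>R\<^esub> a\<close> with \<open>x\<close> in \<open>R\<close>, that is, the left
  ideal \<open>Ra\<close>, also when \<open>R\<close> is not commutative.\<close>

definition comaximal_graph :: "('a, 'm) ring_scheme \<Rightarrow> 'a pair_pre_digraph" where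
  "comaximal_graph R =
    \<lparr>pverts = carrier R,
     parcs = {(a, b). a \<in> carrier R \<and> b \<in> carrier R \<and> a \<noteq> b \<and>
       PIdl\<^bsub>R\<^esub> a <+>\<^bsub>R\<^esub> PIdl\<^bsub>R\<^esub> b = carrier R}\<rparr>"

definition nonunit_nonradical_comaximal_graph ::
    "('a, 'm) ring_scheme \<Rightarrow> ('a, 'a \<times> 'a) pre_digraph" where
  "nonunit_nonradical_comaximal_graph R =
    induce_subgraph (with_proj (comaximal_graph R))
      (carrier R - Units R - jacobson_radical R)"

text \<open>\<open>partition_on\<close> requires the classes to be nonempty; finiteness of \<open>P\<close> is stated because
  infinite sets have \<open>card\<close> 0.\<close>

definition complete_multipartite :: "nat \<Rightarrow> ('a, 'b) pre_digraph \<Rightarrow> bool" where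
  "complete_multipartite n G \<longleftrightarrow>
    (\<exists>P. partition_on (verts G) P \<and> finite P \<and> card P = n \<and>
      (\<forall>A\<in>P. \<forall>u\<in>A. \<forall>v\<in>A. \<not> dominates G u v) \<and>
      (\<forall>A\<in>P. \<forall>u\<in>A. \<forall>v\<in>verts G - A. dominates G u v))"

end

theory Submission
  imports Defs "HOL-Computational_Algebra.Polynomial" "HOL-Number_Theory.Cong"
begin

text \<open>Finiteness of the number of classes forces left invertible elements to be units, so every
  vertex lies in a maximal left ideal. Two vertices in the same maximal left ideal are not adjacent,
  while two distinct maximal left ideals contain adjacent vertices; hence the classes are exactly the
  sets \<open>M - J(R)\<close>, and distinct maximal left ideals meet in \<open>J(R)\<close>. Thus \<open>S = R/J(R)\<close> has exactly \<open>n\<close>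
  maximal left ideals, and two of them meet in zero, which splits \<open>1 = e + f\<close> into orthogonal
  idempotents with \<open>Se\<close> and \<open>Sf\<close> simple. If \<open>eSf = fSe = 0\<close>, then \<open>S\<close> is the product of the
  division rings \<open>eSe\<close> and \<open>fSf\<close>, and \<open>n = 2\<close>. Otherwise a nonzero element of \<open>eSf\<close> or \<open>fSe\<close> extends
  to a system of matrix units, so \<open>S\<close> is the ring of 2 by 2 matrices over the division ring \<open>D = eSe\<close>. Its
  maximal left ideals form a projective line over \<open>D\<close>, so \<open>D\<close> is finite with \<open>n = |D| + 1\<close>, and \<open>D\<close> is
  a field by Wedderburn's little theorem.\<close>

section \<open>Maximal left ideals\<close>

text \<open>Everything is one-sided, and two facts that are free for commutative rings shape the
  beginning. First, a nonunit with a left inverse would generate the whole ring as a left ideal and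
  would thus be a vertex in no maximal left ideal. One such element does not contradict
  independence, because the graph has no loops, so infinitely many have to be produced. Second, the
  radical is an intersection of left ideals, and its closure under multiplication from the right has
  to be proved before the quotient ring makes sense.

  The quotient has length two as a left module over itself, so its structure is found by direct
  computation with the Peirce components of \<open>e\<close> and \<open>f\<close> instead of the
  general theory of semisimple rings. Cyclotomic polynomials enter only through one integer that has
  many divisibility properties and is too large to divide \<open>q - 1\<close>.\<close>

lemma (in ring) additive_subgroupI2:
  assumes "H \<subseteq> carrier R" "\<zero> \<in> H" "\<And>x y. x \<in> H \<Longrightarrow> y \<in> H \<Longrightarrow> x \<oplus> y \<in> H"
    and "\<And>x. x \<in> H \<Longrightarrow> \<ominus> x \<in> H"
  shows "additive_subgroup H R"
  using assms by (intro additive_subgroupI add.subgroupI) (auto simp: a_inv_def)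

lemma (in ring) left_idealI:
  assumes "H \<subseteq> carrier R" "\<zero> \<in> H" "\<And>x y. x \<in> H \<Longrightarrow> y \<in> H \<Longrightarrow> x \<oplus> y \<in> H"
    and mult: "\<And>a x. a \<in> H \<Longrightarrow> x \<in> carrier R \<Longrightarrow> x \<otimes> a \<in> H"
  shows "left_ideal H R"
proof (intro left_ideal.intro left_ideal_axioms.intro additive_subgroupI2 ring_axioms)
  fix x assume x: "x \<in> H"
  then have "\<ominus> \<one> \<otimes> x \<in> H" using mult by simp
  moreover have "x \<in> carrier R" using x assms(1) by blast
  then have "\<ominus> \<one> \<otimes> x = \<ominus> x" by (simp add: l_minus)
  ultimately show "\<ominus> x \<in> H" by simp
qed (use assms in auto)

lemma (in left_ideal) eq_carrier_if_one_mem: "\<one> \<in> I \<Longrightarrow> I = carrier R"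
  using l_closed[of \<one>] a_subset by auto

lemma (in maximal_left_ideal) one_notin: "\<one> \<notin> I"
  using eq_carrier_if_one_mem notcarrier by blast

lemma (in ring) left_ideal_add:
  assumes "left_ideal I R" "left_ideal J R"
  shows "left_ideal (I <+>\<^bsub>R\<^esub> J) R"
proof -
  interpret I: left_ideal I R by fact
  interpret J: left_ideal J R by fact
  show ?thesis
  proof (rule left_idealI)
    show "I <+>\<^bsub>R\<^esub> J \<subseteq> carrier R" by (auto simp: set_add_def')
    have "\<zero> = \<zero> \<oplus> \<zero>" by simp
    then show "\<zero> \<in> I <+>\<^bsub>R\<^esub> J"
      using I.zero_closed J.zero_closed unfolding set_add_def' by blast
  next
    fix x y assume "x \<in> I <+>\<^bsub>R\<^esub> J" "y \<in> I <+>\<^bsub>R\<^esub> J"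
    then obtain i j i' j' where m: "i \<in> I" "j \<in> J" "i' \<in> I" "j' \<in> J"
      and xy: "x = i \<oplus> j" "y = i' \<oplus> j'"
      by (auto simp: set_add_def')
    have "i \<in> carrier R" "j \<in> carrier R" "i' \<in> carrier R" "j' \<in> carrier R"
      using m by auto
    then have "x \<oplus> y = (i \<oplus> i') \<oplus> (j \<oplus> j')"
      unfolding xy by algebra
    then show "x \<oplus> y \<in> I <+>\<^bsub>R\<^esub> J"
      using m unfolding set_add_def' by blast
  next
    fix a x assume "a \<in> I <+>\<^bsub>R\<^esub> J" and x: "x \<in> carrier R"
    then obtain i j where m: "i \<in> I" "j \<in> J" and a: "a = i \<oplus> j"
      by (auto simp: set_add_def')
    have "x \<otimes> a = x \<otimes> i \<oplus> x \<otimes> j"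
      using m x unfolding a by (simp add: r_distr)
    moreover have "x \<otimes> i \<in> I" "x \<otimes> j \<in> J"
      using m x by (simp_all add: I.l_closed J.l_closed)
    ultimately show "x \<otimes> a \<in> I <+>\<^bsub>R\<^esub> J"
      unfolding set_add_def' by blast
  qed
qed

lemma (in ring) left_ideal_PIdl:
  assumes "a \<in> carrier R"
  shows "left_ideal (PIdl a) R"
proof (rule left_idealI)
  show "PIdl a \<subseteq> carrier R" using assms by (auto simp: cgenideal_def)
  have "\<zero> = \<zero> \<otimes> a" using assms by simp
  then show "\<zero> \<in> PIdl a" unfolding cgenideal_def by blast
next
  fix u v assume "u \<in> PIdl a" "v \<in> PIdl a"
  then obtain x y where xy: "x \<in> carrier R" "y \<in> carrier R" "u = x \<otimes> a" "v = y \<otimes> a"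
    by (auto simp: cgenideal_def)
  then have "u \<oplus> v = (x \<oplus> y) \<otimes> a" using assms by (simp add: l_distr)
  then show "u \<oplus> v \<in> PIdl a" using xy unfolding cgenideal_def by blast
next
  fix u x assume "u \<in> PIdl a" and x: "x \<in> carrier R"
  then obtain y where y: "y \<in> carrier R" "u = y \<otimes> a" by (auto simp: cgenideal_def)
  then have "x \<otimes> u = (x \<otimes> y) \<otimes> a" using assms x by (simp add: m_assoc)
  then show "x \<otimes> u \<in> PIdl a" using x y unfolding cgenideal_def by blast
qed

lemma (in left_ideal) PIdl_subset: "a \<in> I \<Longrightarrow> PIdl a \<subseteq> I"
  using l_closed by (auto simp: cgenideal_def)

lemma (in ring) subset_set_add:
  assumes "left_ideal I R" "left_ideal J R"
  shows "I \<subseteq> I <+>\<^bsub>R\<^esub> J" "J \<subseteq> I <+>\<^bsub>R\<^esub> J"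
proof -
  interpret I: left_ideal I R by fact
  interpret J: left_ideal J R by fact
  show "I \<subseteq> I <+>\<^bsub>R\<^esub> J"
  proof
    fix x assume x: "x \<in> I"
    then have "x = x \<oplus> \<zero>" by simp
    then show "x \<in> I <+>\<^bsub>R\<^esub> J" using x J.zero_closed unfolding set_add_def' by blast
  qed
  show "J \<subseteq> I <+>\<^bsub>R\<^esub> J"
  proof
    fix x assume x: "x \<in> J"
    then have "x = \<zero> \<oplus> x" by simp
    then show "x \<in> I <+>\<^bsub>R\<^esub> J" using x I.zero_closed unfolding set_add_def' by blast
  qed
qed

text \<open>\<open>I + Rx\<close> is strictly larger than \<open>I\<close>, hence everything. With
  the converse \<open>maximal_left_idealI\<close>, maximality becomes one equation between elements,
  and later arguments compute with it.\<close>

lemma (in maximal_left_ideal) one_eq_add_mult: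
  assumes "x \<in> carrier R" "x \<notin> I"
  obtains m z where "m \<in> I" "z \<in> carrier R" "\<one> = m \<oplus> z \<otimes> x"
proof -
  have I: "left_ideal I R" by (rule left_ideal_axioms)
  let ?K = "I <+>\<^bsub>R\<^esub> PIdl x"
  have K: "left_ideal ?K R" by (rule left_ideal_add[OF I left_ideal_PIdl[OF assms(1)]])
  have "x \<in> ?K"
    using subset_set_add(2)[OF I left_ideal_PIdl[OF assms(1)]] cgenideal_self[OF assms(1)] by blast
  then have "?K \<noteq> I" using assms(2) by blast
  moreover have "?K \<subseteq> carrier R"
    using additive_subgroup.a_subset[OF left_ideal.axioms(1)[OF K]] .
  ultimately have "?K = carrier R"
    using I_maximal[OF K subset_set_add(1)[OF I left_ideal_PIdl[OF assms(1)]]] by blast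
  then have "\<one> \<in> ?K" by simp
  then show ?thesis using that unfolding set_add_def' cgenideal_def by blast
qed

lemma (in ring) maximal_left_idealI:
  assumes I: "left_ideal I R" and one: "\<one> \<notin> I"
    and comax: "\<And>x. x \<in> carrier R \<Longrightarrow> x \<notin> I \<Longrightarrow> \<exists>m\<in>I. \<exists>z\<in>carrier R. \<one> = m \<oplus> z \<otimes> x"
  shows "maximal_left_ideal I R"
proof (intro maximal_left_ideal.intro maximal_left_ideal_axioms.intro I)
  show "carrier R \<noteq> I" using one by blast
  fix J assume J: "left_ideal J R" "I \<subseteq> J" "J \<subseteq> carrier R"
  interpret J: left_ideal J R by fact
  show "J = I \<or> J = carrier R"
  proof (cases "J = I")
    case False
    then obtain x where x: "x \<in> J" "x \<notin> I" using J by blast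
    then obtain m z where "m \<in> I" "z \<in> carrier R" "\<one> = m \<oplus> z \<otimes> x" using comax[of x] by auto
    then have "\<one> \<in> J" using J(2) x J.l_closed by auto
    then show ?thesis using J.eq_carrier_if_one_mem by blast
  qed simp
qed

text \<open>Zorn's lemma for the left ideals above \<open>I\<close>. Properness is expressed by the
  absence of \<open>\<one>\<close>, which passes to unions of chains.\<close>

lemma (in ring) maximal_left_ideal_exists:
  assumes I: "left_ideal I R" "\<one> \<notin> I"
  obtains M where "maximal_left_ideal M R" "I \<subseteq> M"
proof -
  let ?A = "{L. left_ideal L R \<and> I \<subseteq> L \<and> \<one> \<notin> L}"
  have "\<exists>M\<in>?A. \<forall>Y\<in>?A. M \<subseteq> Y \<longrightarrow> Y = M"
  proof (rule subset_Zorn_nonempty)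
    show "?A \<noteq> {}" using I by blast
    fix C assume C: "C \<noteq> {}" "subset.chain ?A C"
    then have CA: "L \<in> C \<Longrightarrow> left_ideal L R \<and> I \<subseteq> L \<and> \<one> \<notin> L" for L
      by (auto simp: subset_chain_def)
    have sub: "L \<in> C \<Longrightarrow> L \<subseteq> carrier R" for L
      using CA additive_subgroup.a_subset left_ideal.axioms(1) by blast
    have "left_ideal (\<Union> C) R"
    proof (rule left_idealI)
      show "\<Union> C \<subseteq> carrier R" using sub by blast
      show "\<zero> \<in> \<Union> C"
        using C(1) CA additive_subgroup.zero_closed left_ideal.axioms(1) by blast
    next
      fix x y assume "x \<in> \<Union> C" "y \<in> \<Union> C"
      then obtain L L' where L: "L \<in> C" "L' \<in> C" "x \<in> L" "y \<in> L'" by blast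
      then have "L \<subseteq> L' \<or> L' \<subseteq> L" using C(2) by (auto simp: subset_chain_def)
      then obtain K where K: "K \<in> C" "x \<in> K" "y \<in> K" using L by blast
      then interpret left_ideal K R using CA by blast
      show "x \<oplus> y \<in> \<Union> C" using K by blast
    next
      fix a x assume "a \<in> \<Union> C" and x: "x \<in> carrier R"
      then obtain K where K: "K \<in> C" "a \<in> K" by blast
      then interpret left_ideal K R using CA by blast
      show "x \<otimes> a \<in> \<Union> C" using K(1) l_closed[OF K(2) x] by blast
    qed
    then show "\<Union> C \<in> ?A" using C(1) CA by blast
  qed
  then obtain M where MA: "M \<in> ?A" and max: "\<forall>Y\<in>?A. M \<subseteq> Y \<longrightarrow> Y = M" by (rule bexE)
  then have M: "left_ideal M R" "I \<subseteq> M" "\<one> \<notin> M" by simp_all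
  have "maximal_left_ideal M R"
  proof (intro maximal_left_ideal.intro maximal_left_ideal_axioms.intro M)
    show "carrier R \<noteq> M" using M by blast
    fix J assume J: "left_ideal J R" "M \<subseteq> J"
    show "J = M \<or> J = carrier R"
    proof (cases "\<one> \<in> J")
      case True
      then show ?thesis using left_ideal.eq_carrier_if_one_mem[OF J(1)] by simp
    next
      case False
      then have "J \<in> ?A" using J M(2) by simp
      then show ?thesis using max J(2) by simp
    qed
  qed
  then show ?thesis using M(2) that by blast
qed

text \<open>These residuals of maximal left ideals are the annihilators of elements of simple left modules.
  They make the radical, defined by left ideals alone, two-sided.\<close>

lemma (in ring) maximal_left_ideal_residual:
  assumes "maximal_left_ideal M R" "r \<in> carrier R" "r \<notin> M"
  shows "maximal_left_ideal {s \<in> carrier R. s \<otimes> r \<in> M} R"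
proof -
  interpret M: maximal_left_ideal M R by fact
  show ?thesis
  proof (rule maximal_left_idealI)
    show "left_ideal {s \<in> carrier R. s \<otimes> r \<in> M} R"
      using assms(2) M.l_closed by (intro left_idealI) (auto simp: l_distr m_assoc)
    show "\<one> \<notin> {s \<in> carrier R. s \<otimes> r \<in> M}" using assms by simp
  next
    fix x assume x: "x \<in> carrier R" "x \<notin> {s \<in> carrier R. s \<otimes> r \<in> M}"
    then have "x \<otimes> r \<in> carrier R" "x \<otimes> r \<notin> M" using assms(2) by auto
    then obtain m z where mz: "m \<in> M" "z \<in> carrier R" "\<one> = m \<oplus> z \<otimes> (x \<otimes> r)"
      using M.one_eq_add_mult by blast
    have mc: "m \<in> carrier R" using mz by simp
    \<comment> \<open>Multiplying \<open>\<one> = m \<oplus> z \<otimes> (x \<otimes> r)\<close> by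
      \<open>r\<close> from the left turns it into
      \<open>(\<one> \<ominus> w) \<otimes> r = r \<otimes> m\<close>. So
      \<open>\<one> \<ominus> w\<close> lies in the residual, and \<open>r \<otimes> z\<close> is
      the coefficient of \<open>x\<close>.\<close>
    define w where "w = r \<otimes> z \<otimes> x"
    have w: "w \<in> carrier R" using x mz assms by (simp add: w_def)
    have "r = r \<otimes> \<one>" using assms(2) by simp
    also have "\<dots> = r \<otimes> (m \<oplus> z \<otimes> (x \<otimes> r))" by (rule arg_cong[OF mz(3)])
    also have "\<dots> = r \<otimes> m \<oplus> w \<otimes> r"
      using mc mz(2) x(1) assms(2) by (simp add: w_def r_distr m_assoc)
    finally have r: "r = r \<otimes> m \<oplus> w \<otimes> r" .
    have "(\<one> \<ominus> w) \<otimes> r = r \<ominus> w \<otimes> r" using w assms(2) by algebra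
    also have "\<dots> = (r \<otimes> m \<oplus> w \<otimes> r) \<ominus> w \<otimes> r"
      using r by (rule arg_cong)
    also have "\<dots> = r \<otimes> m" using w assms(2) mc by algebra
    finally have "(\<one> \<ominus> w) \<otimes> r \<in> M" using M.l_closed mz assms(2) by simp
    moreover have "\<one> = (\<one> \<ominus> w) \<oplus> (r \<otimes> z) \<otimes> x"
      using w unfolding w_def[symmetric] by algebra
    moreover have "\<one> \<ominus> w \<in> carrier R" "r \<otimes> z \<in> carrier R" using w mz(2) assms(2) by simp_all
    ultimately show "\<exists>m\<in>{s \<in> carrier R. s \<otimes> r \<in> M}. \<exists>z\<in>carrier R. \<one> = m \<oplus> z \<otimes> x"
      by blast
  qed
qed

section \<open>The radical and maximal left ideals of quotients\<close>

lemma (in ring) ideal_jacobson_radical: "ideal (jacobson_radical R) R"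
proof -
  have mem: "x \<in> jacobson_radical R \<longleftrightarrow> x \<in> carrier R \<and> (\<forall>M. maximal_left_ideal M R \<longrightarrow> x \<in> M)" for x
    by (auto simp: jacobson_radical_def max_left_ideals_def)
  have "left_ideal (jacobson_radical R) R"
  proof (rule left_idealI)
    show "jacobson_radical R \<subseteq> carrier R" by (auto simp: mem)
    have ideal: "left_ideal M R" if "maximal_left_ideal M R" for M
      by (rule maximal_left_ideal.axioms(1)[OF that])
    note subgroup = left_ideal.axioms(1)[OF ideal]
    show "\<zero> \<in> jacobson_radical R"
      using additive_subgroup.zero_closed[OF subgroup] by (simp add: mem)
    show "x \<oplus> y \<in> jacobson_radical R" if "x \<in> jacobson_radical R" "y \<in> jacobson_radical R" for x y
      using that additive_subgroup.a_closed[OF subgroup] by (simp add: mem)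
    show "x \<otimes> a \<in> jacobson_radical R" if "a \<in> jacobson_radical R" "x \<in> carrier R" for a x
      using that left_ideal.l_closed[OF ideal] by (simp add: mem)
  qed
  moreover have "a \<otimes> x \<in> jacobson_radical R"
    if a: "a \<in> jacobson_radical R" and x: "x \<in> carrier R" for a x
  proof -
    have "a \<otimes> x \<in> M" if M: "maximal_left_ideal M R" for M
    proof (cases "x \<in> M")
      case True
      then show ?thesis
        using a left_ideal.l_closed[OF maximal_left_ideal.axioms(1)[OF M]] by (auto simp: mem)
    next
      case False
      \<comment> \<open>The residual of \<open>M\<close> by \<open>x\<close> is again a maximal left
        ideal, so it contains \<open>a\<close>.\<close>
      then show ?thesis
        using maximal_left_ideal_residual[OF M x] a by (auto simp: mem)
    qed
    then show ?thesis using a x by (auto simp: mem)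
  qed
  ultimately show ?thesis
    by (intro ideal.intro ideal_axioms.intro ring_axioms)
      (auto dest: left_ideal.axioms left_ideal.l_closed)
qed

text \<open>The kernel condition makes every maximal left ideal a union of fibres of
  \<open>h\<close>, so images and preimages are mutually inverse. For the quotient by the radical
  the condition holds by definition, and no maximal left ideal is lost.\<close>

lemma (in ring_hom_ring) bij_betw_max_left_ideals:
  assumes surj: "h ` carrier R = carrier S"
    and ker: "\<And>M. maximal_left_ideal M R \<Longrightarrow> a_kernel R S h \<subseteq> M"
  shows "bij_betw ((`) h) (max_left_ideals R) (max_left_ideals S)"
proof (rule bij_betwI[where g = "\<lambda>L. {x \<in> carrier R. h x \<in> L}"])
  have kerD: "u \<in> M" if M: "maximal_left_ideal M R" and u: "u \<in> carrier R" and m: "m \<in> M"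
    and eq: "h u = h m" for M u m
  proof -
    interpret M: maximal_left_ideal M R by fact
    have mc: "m \<in> carrier R" using m by simp
    have "h (u \<ominus> m) = h u \<oplus>\<^bsub>S\<^esub> (\<ominus>\<^bsub>S\<^esub> h m)" using u mc by (simp add: R.minus_eq)
    also have "\<dots> = \<zero>\<^bsub>S\<^esub>" unfolding eq using mc by (simp add: S.r_neg)
    finally have "h (u \<ominus> m) = \<zero>\<^bsub>S\<^esub>" .
    then have "u \<ominus> m \<in> a_kernel R S h" using R.minus_closed[OF u mc] unfolding a_kernel_def' by blast
    then have "u \<ominus> m \<in> M" using ker[OF M] by blast
    then have "(u \<ominus> m) \<oplus> m \<in> M" using m by (rule M.a_closed)
    moreover have "(u \<ominus> m) \<oplus> m = u" using u mc by (simp add: R.minus_eq R.a_assoc R.l_neg)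
    ultimately show ?thesis by simp
  qed
  show "(`) h \<in> max_left_ideals R \<rightarrow> max_left_ideals S"
  proof
    fix M assume "M \<in> max_left_ideals R"
    then have M: "maximal_left_ideal M R" by (simp add: max_left_ideals_def)
    interpret M: maximal_left_ideal M R by fact
    have "maximal_left_ideal (h ` M) S"
    proof (rule S.maximal_left_idealI)
      show "left_ideal (h ` M) S"
      proof (rule S.left_idealI)
        show "h ` M \<subseteq> carrier S" by auto
        show "\<zero>\<^bsub>S\<^esub> \<in> h ` M" using M.zero_closed by (metis hom_zero image_eqI)
      next
        fix x y assume "x \<in> h ` M" "y \<in> h ` M"
        then obtain u v where uv: "u \<in> M" "v \<in> M" "x = h u" "y = h v" by blast
        then have "x \<oplus>\<^bsub>S\<^esub> y = h (u \<oplus> v)" by simp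
        then show "x \<oplus>\<^bsub>S\<^esub> y \<in> h ` M" using uv by blast
      next
        fix a x assume "a \<in> h ` M" "x \<in> carrier S"
        then obtain u v where uv: "u \<in> M" "v \<in> carrier R" "a = h u" "x = h v" using surj by blast
        then have "x \<otimes>\<^bsub>S\<^esub> a = h (v \<otimes> u)" by simp
        then show "x \<otimes>\<^bsub>S\<^esub> a \<in> h ` M" using M.l_closed[OF uv(1,2)] by simp
      qed
      show "\<one>\<^bsub>S\<^esub> \<notin> h ` M"
      proof
        assume "\<one>\<^bsub>S\<^esub> \<in> h ` M"
        then obtain m where "m \<in> M" "h \<one> = h m" by auto
        then show False using kerD[OF M R.one_closed] M.one_notin by blast
      qed
    next
      fix y assume y: "y \<in> carrier S" "y \<notin> h ` M"
      then obtain x where x: "x \<in> carrier R" "y = h x" using surj by blast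
      with y have "x \<notin> M" by blast
      then obtain m z where mz: "m \<in> M" "z \<in> carrier R" "\<one> = m \<oplus> z \<otimes> x"
        using M.one_eq_add_mult x by blast
      have "\<one>\<^bsub>S\<^esub> = h \<one>" by simp
      also have "\<dots> = h (m \<oplus> z \<otimes> x)" by (rule arg_cong[OF mz(3)])
      also have "\<dots> = h m \<oplus>\<^bsub>S\<^esub> h z \<otimes>\<^bsub>S\<^esub> y" using mz(1,2) x by simp
      finally show "\<exists>m\<in>h ` M. \<exists>z\<in>carrier S. \<one>\<^bsub>S\<^esub> = m \<oplus>\<^bsub>S\<^esub> z \<otimes>\<^bsub>S\<^esub> y"
        using mz(1) hom_closed[OF mz(2)] by blast
    qed
    then show "h ` M \<in> max_left_ideals S" by (simp add: max_left_ideals_def)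
  qed
  show "(\<lambda>L. {x \<in> carrier R. h x \<in> L}) \<in> max_left_ideals S \<rightarrow> max_left_ideals R"
  proof
    fix L assume "L \<in> max_left_ideals S"
    then interpret L: maximal_left_ideal L S by (simp add: max_left_ideals_def)
    have "maximal_left_ideal {x \<in> carrier R. h x \<in> L} R"
    proof (rule R.maximal_left_idealI)
      show "left_ideal {x \<in> carrier R. h x \<in> L} R"
        using L.l_closed L.zero_closed by (intro R.left_idealI) auto
      show "\<one> \<notin> {x \<in> carrier R. h x \<in> L}" using L.one_notin by simp
    next
      fix x assume x: "x \<in> carrier R" "x \<notin> {x \<in> carrier R. h x \<in> L}"
      then obtain l y where ly: "l \<in> L" "y \<in> carrier S" "\<one>\<^bsub>S\<^esub> = l \<oplus>\<^bsub>S\<^esub> y \<otimes>\<^bsub>S\<^esub> h x"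
        using L.one_eq_add_mult[of "h x"] by auto
      then obtain z where z: "z \<in> carrier R" "y = h z" using surj by blast
      have lc: "l \<in> carrier S" using ly by simp
      \<comment> \<open>An arbitrary preimage of \<open>l\<close> would satisfy the equation only up
        to the kernel. The preimage \<open>\<one> \<ominus> z \<otimes> x\<close> satisfies it
        exactly.\<close>
      have "h (\<one> \<ominus> z \<otimes> x) = \<one>\<^bsub>S\<^esub> \<ominus>\<^bsub>S\<^esub> h z \<otimes>\<^bsub>S\<^esub> h x"
        using x z by (simp add: R.minus_eq S.minus_eq)
      also have "\<dots> = (l \<oplus>\<^bsub>S\<^esub> h z \<otimes>\<^bsub>S\<^esub> h x) \<ominus>\<^bsub>S\<^esub> h z \<otimes>\<^bsub>S\<^esub> h x"
        by (simp only: ly(3)[symmetric] z(2)[symmetric])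
      also have "\<dots> = l"
        using lc x z by (simp add: S.minus_eq S.a_assoc S.r_neg)
      finally have "h (\<one> \<ominus> z \<otimes> x) \<in> L" using ly by simp
      moreover have "\<one> = (\<one> \<ominus> z \<otimes> x) \<oplus> z \<otimes> x" using x z by (simp add: R.minus_eq R.a_assoc R.l_neg)
      ultimately show "\<exists>m\<in>{x \<in> carrier R. h x \<in> L}. \<exists>z\<in>carrier R. \<one> = m \<oplus> z \<otimes> x"
        using R.minus_closed[OF R.one_closed R.m_closed[OF z(1) x(1)]] z(1) by blast
    qed
    then show "{x \<in> carrier R. h x \<in> L} \<in> max_left_ideals R" by (simp add: max_left_ideals_def)
  qed
  show "{x \<in> carrier R. h x \<in> h ` M} = M" if "M \<in> max_left_ideals R" for M
  proof -
    have M: "maximal_left_ideal M R" using that by (simp add: max_left_ideals_def)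
    interpret M: maximal_left_ideal M R by fact
    show ?thesis using kerD[OF M] by auto
  qed
  show "h ` {x \<in> carrier R. h x \<in> L} = L" if "L \<in> max_left_ideals S" for L
  proof -
    interpret L: maximal_left_ideal L S using that by (simp add: max_left_ideals_def)
    show ?thesis using surj L.a_subset by auto
  qed
qed

section \<open>Classes of the comaximal graph\<close>

lemma verts_nonunit_nonradical_comaximal_graph:
  "verts (nonunit_nonradical_comaximal_graph R) = carrier R - Units R - jacobson_radical R"
  by (simp add: nonunit_nonradical_comaximal_graph_def)

lemma dominates_nonunit_nonradical_comaximal_graph:
  "dominates (nonunit_nonradical_comaximal_graph R) u v \<longleftrightarrow>
    u \<in> carrier R - Units R - jacobson_radical R \<and> v \<in> carrier R - Units R - jacobson_radical R \<and>
    u \<noteq> v \<and> PIdl\<^bsub>R\<^esub> u <+>\<^bsub>R\<^esub> PIdl\<^bsub>R\<^esub> v = carrier R"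
  by (auto simp: nonunit_nonradical_comaximal_graph_def comaximal_graph_def arcs_ends_conv image_iff)

section \<open>Powers of left invertible elements\<close>

lemma (in monoid) Units_if_left_right_inverse:
  assumes "a \<in> carrier G" "x \<in> carrier G" "y \<in> carrier G" "x \<otimes> a = \<one>" "a \<otimes> y = \<one>"
  shows "a \<in> Units G"
proof -
  have "x = y" by (rule inv_unique[OF assms(4,5,1-3)])
  then show ?thesis using assms unfolding Units_def by blast
qed

lemma (in monoid) pow_left_inverse:
  assumes "a \<in> carrier G" "x \<in> carrier G" "x \<otimes> a = \<one>"
  shows "x [^] (n::nat) \<otimes> a [^] n = \<one>"
proof (induction n)
  case (Suc n)
  have "x [^] Suc n \<otimes> a [^] Suc n = (x [^] n \<otimes> x) \<otimes> (a \<otimes> a [^] n)"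
    by (simp only: nat_pow_Suc2[OF assms(1)] nat_pow_Suc[of x])
  also have "\<dots> = x [^] n \<otimes> (x \<otimes> a) \<otimes> a [^] n"
    using assms(1,2) by (simp only: m_assoc nat_pow_closed m_closed)
  finally show ?case using assms Suc by (simp del: nat_pow_Suc)
qed simp

text \<open>\<open>x [^] i\<close> cancels \<open>a [^] i\<close> from the left. Hence two equal
  powers would make a positive power of \<open>a\<close> equal to \<open>\<one>\<close>, and
  \<open>a\<close> would acquire a right inverse.\<close>

lemma (in monoid) inj_pow_left_invertible_nonunit:
  assumes a: "a \<in> carrier G" "a \<notin> Units G" and x: "x \<in> carrier G" "x \<otimes> a = \<one>"
  shows "inj (\<lambda>n::nat. a [^] n)"
proof -
  have False if "i < j" "a [^] i = a [^] j" for i j :: nat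
  proof -
    obtain k where k: "j = i + Suc k" using \<open>i < j\<close> less_imp_Suc_add by auto
    have eq: "a [^] i = a [^] i \<otimes> a [^] Suc k"
      unfolding nat_pow_mult[OF a(1)] k[symmetric] by (rule that(2))
    have "\<one> = x [^] i \<otimes> a [^] i" using pow_left_inverse[OF a(1) x] by simp
    also have "\<dots> = x [^] i \<otimes> (a [^] i \<otimes> a [^] Suc k)"
      by (rule arg_cong[OF eq])
    also have "\<dots> = (x [^] i \<otimes> a [^] i) \<otimes> a [^] Suc k"
      using a(1) x(1) by (simp only: m_assoc nat_pow_closed)
    also have "\<dots> = a \<otimes> a [^] k"
      using pow_left_inverse[OF a(1) x, of i] a(1) by (simp only: nat_pow_Suc2 l_one nat_pow_closed m_closed)
    finally show False
      using Units_if_left_right_inverse[OF a(1) x(1) _ x(2), of "a [^] k"] a by simp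
  qed
  then show ?thesis by (metis (no_types, lifting) injI linorder_neqE_nat)
qed

lemma (in monoid) pow_Suc_left_invertible_nonunit:
  assumes a: "a \<in> carrier G" "a \<notin> Units G" and x: "x \<in> carrier G" "x \<otimes> a = \<one>"
  shows "a [^] Suc n \<notin> Units G"
proof
  assume u: "a [^] Suc n \<in> Units G"
  then have c: "inv (a [^] Suc n) \<in> carrier G" by simp
  have "a \<otimes> (a [^] n \<otimes> inv (a [^] Suc n)) = (a \<otimes> a [^] n) \<otimes> inv (a [^] Suc n)"
    using a(1) c by (simp only: m_assoc nat_pow_closed)
  also have "\<dots> = \<one>"
    using u a(1) by (simp only: nat_pow_Suc2[symmetric] Units_r_inv)
  finally have r: "a \<otimes> (a [^] n \<otimes> inv (a [^] Suc n)) = \<one>" .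
  have "a [^] n \<otimes> inv (a [^] Suc n) \<in> carrier G" using a(1) c by (rule m_closed[OF nat_pow_closed])
  from Units_if_left_right_inverse[OF a(1) x(1) this x(2) r] show False using a(2) by contradiction
qed

section \<open>Classes and maximal left ideals\<close>

text \<open>The graph hypothesis with adjacency read as comaximality. \<open>independent\<close> is
  limited to distinct elements because a loop-free graph says nothing about \<open>u = v\<close>,
  even when \<open>PIdl u\<close> is the whole ring.\<close>

locale complete_multipartite_comaximal = ring +
  fixes P
  assumes partition: "partition_on (carrier R - Units R - jacobson_radical R) P"
    and finite_P: "finite P"
    and independent: "\<And>A u v. A \<in> P \<Longrightarrow> u \<in> A \<Longrightarrow> v \<in> A \<Longrightarrow> u \<noteq> v \<Longrightarrow>
      PIdl u <+>\<^bsub>R\<^esub> PIdl v \<noteq> carrier R"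
    and complete: "\<And>A u v. A \<in> P \<Longrightarrow> u \<in> A \<Longrightarrow> v \<in> carrier R - Units R - jacobson_radical R \<Longrightarrow>
      v \<notin> A \<Longrightarrow> PIdl u <+>\<^bsub>R\<^esub> PIdl v = carrier R"
    and two_maximal: "\<exists>M N. maximal_left_ideal M R \<and> maximal_left_ideal N R \<and> M \<noteq> N"
begin

lemma Union_P: "\<Union> P = carrier R - Units R - jacobson_radical R"
  using partition by (simp add: partition_on_def)

lemma P_disjoint: "A \<in> P \<Longrightarrow> B \<in> P \<Longrightarrow> x \<in> A \<Longrightarrow> x \<in> B \<Longrightarrow> A = B"
  using partition unfolding partition_on_def disjoint_def by blast

lemma mem_jacobson_radicalD: "x \<in> jacobson_radical R \<Longrightarrow> maximal_left_ideal M R \<Longrightarrow> x \<in> M"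
  by (auto simp: jacobson_radical_def max_left_ideals_def)

lemma left_invertible_notin:
  assumes M: "maximal_left_ideal M R" and a: "a \<in> carrier R" and x: "x \<in> carrier R" "x \<otimes> a = \<one>"
  shows "a \<notin> M"
  using left_ideal.l_closed[OF maximal_left_ideal.axioms(1)[OF M], of a x] x
    maximal_left_ideal.one_notin[OF M] by auto

lemma PIdl_add_eq_carrier:
  assumes "a \<in> carrier R" "b \<in> carrier R" "\<one> \<in> PIdl a <+>\<^bsub>R\<^esub> PIdl b"
  shows "PIdl a <+>\<^bsub>R\<^esub> PIdl b = carrier R"
  using left_ideal.eq_carrier_if_one_mem[OF left_ideal_add[OF left_ideal_PIdl left_ideal_PIdl]] assms
  by blast

text \<open>The powers of a left invertible nonunit would be infinitely many pairwise adjacent vertices.\<close>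

lemma left_invertible_imp_Units:
  assumes a: "a \<in> carrier R" and x: "x \<in> carrier R" "x \<otimes> a = \<one>"
  shows "a \<in> Units R"
proof (rule ccontr)
  assume na: "a \<notin> Units R"
  \<comment> \<open>The exponents start at one, since \<open>a [^] 0\<close> is a unit and hence no
    vertex.\<close>
  define p where "p = (\<lambda>n::nat. a [^] Suc n)"
  have pc: "p n \<in> carrier R" for n using a by (simp add: p_def)
  have xc: "x [^] Suc n \<in> carrier R" for n using x by simp
  have xp: "x [^] Suc n \<otimes> p n = \<one>" for n
    unfolding p_def by (rule pow_left_inverse[OF a x])
  obtain M where M: "maximal_left_ideal M R" using two_maximal by blast
  have pV: "p n \<in> carrier R - Units R - jacobson_radical R" for n
  proof -
    have "p n \<notin> Units R" unfolding p_def by (rule pow_Suc_left_invertible_nonunit[OF a na x])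
    moreover have "p n \<notin> M" by (rule left_invertible_notin[OF M pc xc xp])
    then have "p n \<notin> jacobson_radical R" using mem_jacobson_radicalD[OF _ M] by blast
    ultimately show ?thesis using pc by blast
  qed
  then have "\<forall>n. \<exists>A. A \<in> P \<and> p n \<in> A" using Union_P by blast
  then obtain c where c: "\<And>n. c n \<in> P" "\<And>n. p n \<in> c n" by metis
  \<comment> \<open>Each power generates the whole ring as a left ideal, so it is adjacent to every
    other one and shares its class with none of them.\<close>
  have "inj c"
  proof (rule injI)
    fix i j assume eq: "c i = c j"
    show "i = j"
    proof (rule ccontr)
      assume "i \<noteq> j"
      then have "p i \<noteq> p j"
        using injD[OF inj_pow_left_invertible_nonunit[OF a na x], of "Suc i" "Suc j"]
        unfolding p_def by blast
      then have "PIdl (p i) <+>\<^bsub>R\<^esub> PIdl (p j) \<noteq> carrier R"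
        using independent[OF c(1)[of i] c(2)[of i]] c(2)[of j] eq by simp
      moreover have "x [^] Suc i \<otimes> p i \<in> PIdl (p i)"
        using xc[of i] unfolding cgenideal_def by blast
      then have "\<one> \<in> PIdl (p i)" by (simp only: xp)
      then have "\<one> \<in> PIdl (p i) <+>\<^bsub>R\<^esub> PIdl (p j)"
        using subset_set_add(1)[OF left_ideal_PIdl[OF pc] left_ideal_PIdl[OF pc]] by blast
      ultimately show False using PIdl_add_eq_carrier[OF pc pc] by blast
    qed
  qed
  then have "infinite (range c)" by (rule range_inj_infinite)
  moreover have "range c \<subseteq> P" using c(1) by blast
  ultimately show False using finite_P finite_subset by blast
qed

text \<open>A maximal left ideal inside the radical would be contained in a second one and therefore
  equal to it. This makes the prospective class \<open>M - jacobson_radical R\<close>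
  nonempty.\<close>

lemma maximal_not_subset_radical:
  assumes M: "maximal_left_ideal M R"
  obtains u where "u \<in> M" "u \<notin> jacobson_radical R"
proof -
  obtain N where N: "maximal_left_ideal N R" "N \<noteq> M" using two_maximal by metis
  have "\<not> M \<subseteq> jacobson_radical R"
  proof
    assume "M \<subseteq> jacobson_radical R"
    then have "M \<subseteq> N" using mem_jacobson_radicalD[OF _ N(1)] by blast
    then have "N = M \<or> N = carrier R"
      using maximal_left_ideal.I_maximal[OF M maximal_left_ideal.axioms(1)[OF N(1)]]
        additive_subgroup.a_subset[OF left_ideal.axioms(1)[OF maximal_left_ideal.axioms(1)[OF N(1)]]]
      by blast
    then show False using N maximal_left_ideal.notcarrier[OF N(1)] by blast
  qed
  then show ?thesis using that by blast
qed

lemma maximal_vertex: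
  assumes M: "maximal_left_ideal M R" and u: "u \<in> M" "u \<notin> jacobson_radical R"
  shows "u \<in> carrier R - Units R - jacobson_radical R"
proof -
  interpret M: maximal_left_ideal M R by fact
  have "u \<in> carrier R" using u by simp
  moreover have "u \<notin> Units R"
  proof
    assume "u \<in> Units R"
    then show False
      using left_invertible_notin[OF M _ Units_inv_closed Units_l_inv] u(1) by blast
  qed
  ultimately show ?thesis using u by blast
qed

text \<open>\<open>Ra\<close> is proper because a left inverse of \<open>a\<close> would already
  make \<open>a\<close> a unit.\<close>

lemma vertex_in_maximal:
  assumes a: "a \<in> carrier R" "a \<notin> Units R"
  obtains M where "maximal_left_ideal M R" "a \<in> M"
proof -
  have "\<one> \<notin> PIdl a"
  proof
    assume "\<one> \<in> PIdl a"
    then obtain x where "x \<in> carrier R" "x \<otimes> a = \<one>" unfolding cgenideal_def by auto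
    then show False using left_invertible_imp_Units[OF a(1)] a(2) by blast
  qed
  then obtain M where "maximal_left_ideal M R" "PIdl a \<subseteq> M"
    using maximal_left_ideal_exists[OF left_ideal_PIdl[OF a(1)]] by blast
  then show ?thesis using that cgenideal_self[OF a(1)] by blast
qed

text \<open>For \<open>u\<close> and \<open>v\<close> in \<open>M\<close> the sum
  \<open>Ru + Rv\<close> stays inside \<open>M\<close>, so the two are not adjacent; in a complete
  multipartite graph they share a class.\<close>

lemma maximal_in_class:
  assumes M: "maximal_left_ideal M R" and A: "A \<in> P"
    and u: "u \<in> M" "u \<in> A" and v: "v \<in> M" "v \<notin> jacobson_radical R"
  shows "v \<in> A"
proof (rule ccontr)
  assume "v \<notin> A"
  interpret M: maximal_left_ideal M R by fact
  have "PIdl u <+>\<^bsub>R\<^esub> PIdl v = carrier R"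
    using complete[OF A u(2) maximal_vertex[OF M v] \<open>v \<notin> A\<close>] .
  moreover have "PIdl u <+>\<^bsub>R\<^esub> PIdl v \<subseteq> M"
  proof
    fix w assume "w \<in> PIdl u <+>\<^bsub>R\<^esub> PIdl v"
    then obtain p r where "p \<in> PIdl u" "r \<in> PIdl v" and w: "w = p \<oplus> r"
      unfolding set_add_def' by blast
    then have "p \<in> M" "r \<in> M" using M.PIdl_subset u(1) v(1) by blast+
    then show "w \<in> M" unfolding w by (rule M.a_closed)
  qed
  ultimately show False using M.one_notin by blast
qed

text \<open>Distinct maximal left ideals are comaximal, say
  \<open>\<one> = m \<oplus> z \<otimes> n\<close>. Neither summand lies in both ideals, since
  otherwise \<open>\<one>\<close> would lie in one of them. So both are vertices, they are adjacent,
  and yet \<open>maximal_in_class\<close> would put both into \<open>A\<close>.\<close>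

lemma maximal_eq_if_same_class:
  assumes M: "maximal_left_ideal M R" and N: "maximal_left_ideal N R" and A: "A \<in> P"
    and u: "u \<in> M" "u \<in> A" and v: "v \<in> N" "v \<in> A"
  shows "M = N"
proof (rule ccontr)
  assume ne: "M \<noteq> N"
  interpret M: maximal_left_ideal M R by fact
  interpret N: maximal_left_ideal N R by fact
  have "\<not> N \<subseteq> M"
    using N.I_maximal[OF M.left_ideal_axioms _ M.a_subset] ne M.notcarrier by blast
  then obtain n where n: "n \<in> N" "n \<notin> M" by blast
  have nc: "n \<in> carrier R" using n by simp
  obtain m z where mz: "m \<in> M" "z \<in> carrier R" "\<one> = m \<oplus> z \<otimes> n"
    using M.one_eq_add_mult[OF nc n(2)] by blast
  have zn: "z \<otimes> n \<in> N" "z \<otimes> n \<in> carrier R" "m \<in> carrier R"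
    using N.l_closed[OF n(1) mz(2)] mz n by simp_all
  have "m \<notin> N"
  proof
    assume "m \<in> N"
    then have "m \<oplus> z \<otimes> n \<in> N" using zn(1) by (rule N.a_closed)
    then show False using N.one_notin mz(3) by simp
  qed
  then have mJ: "m \<notin> jacobson_radical R" using mem_jacobson_radicalD[OF _ N] by blast
  have "z \<otimes> n \<notin> M"
  proof
    assume "z \<otimes> n \<in> M"
    with mz(1) have "m \<oplus> z \<otimes> n \<in> M" by (rule M.a_closed)
    then show False using M.one_notin mz(3) by simp
  qed
  then have znJ: "z \<otimes> n \<notin> jacobson_radical R" using mem_jacobson_radicalD[OF _ M] by blast
  have "m \<in> A" by (rule maximal_in_class[OF M A u mz(1) mJ])
  moreover have "z \<otimes> n \<in> A" by (rule maximal_in_class[OF N A v zn(1) znJ])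
  moreover have "m \<noteq> z \<otimes> n" using \<open>m \<notin> N\<close> zn(1) by blast
  ultimately have "PIdl m <+>\<^bsub>R\<^esub> PIdl (z \<otimes> n) \<noteq> carrier R"
    using independent[OF A] by blast
  moreover have "\<one> \<in> PIdl m <+>\<^bsub>R\<^esub> PIdl (z \<otimes> n)"
    using cgenideal_self[OF zn(3)] cgenideal_self[OF zn(2)] mz(3) unfolding set_add_def' by blast
  ultimately show False using PIdl_add_eq_carrier[OF zn(3,2)] by blast
qed

lemma maximal_class:
  assumes M: "maximal_left_ideal M R"
  shows "M - jacobson_radical R \<in> P"
proof -
  obtain u where u: "u \<in> M" "u \<notin> jacobson_radical R" using maximal_not_subset_radical[OF M] .
  then obtain A where A: "A \<in> P" "u \<in> A" using maximal_vertex[OF M] Union_P by blast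
  have "A = M - jacobson_radical R"
  proof (intro equalityI subsetI)
    fix v assume v: "v \<in> A"
    then have vV: "v \<in> carrier R - Units R - jacobson_radical R" using A(1) Union_P by blast
    then obtain N where N: "maximal_left_ideal N R" "v \<in> N" using vertex_in_maximal by blast
    have "M = N" by (rule maximal_eq_if_same_class[OF M N(1) A(1) u(1) A(2) N(2) v])
    then show "v \<in> M - jacobson_radical R" using N(2) vV by blast
  next
    fix v assume "v \<in> M - jacobson_radical R"
    then show "v \<in> A" using maximal_in_class[OF M A(1) u(1) A(2)] by blast
  qed
  then show ?thesis using A(1) by simp
qed

lemma bij_betw_max_left_ideals_P: "bij_betw (\<lambda>M. M - jacobson_radical R) (max_left_ideals R) P"
proof (rule bij_betw_imageI)
  show "inj_on (\<lambda>M. M - jacobson_radical R) (max_left_ideals R)"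
  proof (rule inj_onI)
    fix M N assume "M \<in> max_left_ideals R" "N \<in> max_left_ideals R"
      and eq: "M - jacobson_radical R = N - jacobson_radical R"
    then have MN: "maximal_left_ideal M R" "maximal_left_ideal N R" by (simp_all add: max_left_ideals_def)
    obtain u where "u \<in> M" "u \<notin> jacobson_radical R" using maximal_not_subset_radical[OF MN(1)] .
    then show "M = N"
      using maximal_eq_if_same_class[OF MN maximal_class[OF MN(1)], of u u] eq by blast
  qed
  show "(\<lambda>M. M - jacobson_radical R) ` max_left_ideals R = P"
  proof (intro equalityI subsetI)
    fix A assume A: "A \<in> P"
    then have "A \<noteq> {}" using partition by (auto simp: partition_on_def)
    then obtain u where u: "u \<in> A" by blast
    then have uV: "u \<in> carrier R - Units R - jacobson_radical R" using A Union_P by blast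
    then obtain M where M: "maximal_left_ideal M R" "u \<in> M" using vertex_in_maximal by blast
    have "A = M - jacobson_radical R"
      using P_disjoint[OF A maximal_class[OF M(1)] u] M(2) uV by blast
    then show "A \<in> (\<lambda>M. M - jacobson_radical R) ` max_left_ideals R"
      using M(1) by (auto simp: max_left_ideals_def)
  qed (use maximal_class in \<open>auto simp: max_left_ideals_def\<close>)
qed

text \<open>A common element outside the radical would be a vertex in the classes of both
  ideals.\<close>

lemma maximal_Int_maximal:
  assumes M: "maximal_left_ideal M R" and N: "maximal_left_ideal N R" and "M \<noteq> N"
  shows "M \<inter> N = jacobson_radical R"
proof (intro equalityI subsetI)
  fix x assume x: "x \<in> M \<inter> N"
  show "x \<in> jacobson_radical R"
  proof (rule ccontr)
    assume "x \<notin> jacobson_radical R"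
    then show False
      using maximal_eq_if_same_class[OF M N maximal_class[OF M], of x x] x \<open>M \<noteq> N\<close> by blast
  qed
qed (use mem_jacobson_radicalD M N in blast)

end

section \<open>Rings that are the sum of two simple left ideals\<close>

text \<open>This is \<open>eRe\<close>, a ring with its own unity \<open>e\<close>. Describing it by
  fixed points rather than by products makes membership a pair of equations.\<close>

definition corner :: "('a, 'm) ring_scheme \<Rightarrow> 'a \<Rightarrow> ('a, 'm) ring_scheme" where
  "corner R e = R\<lparr>carrier := {x \<in> carrier R. e \<otimes>\<^bsub>R\<^esub> x = x \<and> x \<otimes>\<^bsub>R\<^esub> e = x}, one := e\<rparr>"

lemma corner_simps:
  "carrier (corner R e) = {x \<in> carrier R. e \<otimes>\<^bsub>R\<^esub> x = x \<and> x \<otimes>\<^bsub>R\<^esub> e = x}"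
  "monoid.mult (corner R e) = monoid.mult R" "ring.add (corner R e) = ring.add R"
  "monoid.one (corner R e) = e" "ring.zero (corner R e) = ring.zero R"
  by (simp_all add: corner_def)

lemma (in ring) ring_corner:
  assumes e: "e \<in> carrier R" "e \<otimes> e = e"
  shows "ring (corner R e)"
proof (rule ringI)
  show "abelian_group (corner R e)"
  proof (rule abelian_groupI)
    fix x assume "x \<in> carrier (corner R e)"
    then have "\<ominus> x \<in> carrier (corner R e)" "\<ominus> x \<oplus>\<^bsub>corner R e\<^esub> x = \<zero>\<^bsub>corner R e\<^esub>"
      using e by (auto simp: corner_simps l_minus r_minus l_neg)
    then show "\<exists>y\<in>carrier (corner R e). y \<oplus>\<^bsub>corner R e\<^esub> x = \<zero>\<^bsub>corner R e\<^esub>" by blast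
  qed (use e in \<open>auto simp: corner_simps l_distr r_distr a_assoc intro: a_comm\<close>)
  show "Group.monoid (corner R e)"
  proof (rule monoidI)
    fix x y assume "x \<in> carrier (corner R e)" "y \<in> carrier (corner R e)"
    then have xy: "x \<in> carrier R" "y \<in> carrier R" "e \<otimes> x = x" "y \<otimes> e = y" by (auto simp: corner_simps)
    have "e \<otimes> (x \<otimes> y) = (e \<otimes> x) \<otimes> y" "(x \<otimes> y) \<otimes> e = x \<otimes> (y \<otimes> e)"
      using xy(1,2) e(1) by (simp_all only: m_assoc)
    then show "x \<otimes>\<^bsub>corner R e\<^esub> y \<in> carrier (corner R e)"
      using xy by (simp add: corner_simps)
  qed (use e in \<open>auto simp: corner_simps m_assoc\<close>)
qed (auto simp: corner_simps l_distr r_distr)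

text \<open>The two \<open>simple\<close> conditions say that the left modules \<open>Re\<close> and \<open>Rf\<close> are simple.\<close>

locale two_simple_idempotents = ring +
  fixes e f
  assumes e_closed [simp]: "e \<in> carrier R" and f_closed [simp]: "f \<in> carrier R"
    and ee [simp]: "e \<otimes> e = e" and ff [simp]: "f \<otimes> f = f"
    and ef [simp]: "e \<otimes> f = \<zero>" and fe [simp]: "f \<otimes> e = \<zero>"
    and e_add_f: "e \<oplus> f = \<one>"
    and e_nonzero: "e \<noteq> \<zero>" and f_nonzero: "f \<noteq> \<zero>"
    and simple_e: "\<And>x. x \<in> carrier R \<Longrightarrow> x \<otimes> e \<noteq> \<zero> \<Longrightarrow> \<exists>y\<in>carrier R. y \<otimes> (x \<otimes> e) = e"
    and simple_f: "\<And>x. x \<in> carrier R \<Longrightarrow> x \<otimes> f \<noteq> \<zero> \<Longrightarrow> \<exists>y\<in>carrier R. y \<otimes> (x \<otimes> f) = f"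
begin

lemma swap: "two_simple_idempotents R f e"
proof (intro two_simple_idempotents.intro two_simple_idempotents_axioms.intro ring_axioms)
  show "f \<oplus> e = \<one>" using e_add_f a_comm by simp
qed (use e_nonzero f_nonzero simple_e simple_f in auto)

lemma idempotent_assoc [simp]:
  assumes "x \<in> carrier R"
  shows "e \<otimes> (e \<otimes> x) = e \<otimes> x" "f \<otimes> (f \<otimes> x) = f \<otimes> x"
    "e \<otimes> (f \<otimes> x) = \<zero>" "f \<otimes> (e \<otimes> x) = \<zero>"
  using assms by (simp_all flip: m_assoc)

lemma right_decomposition: "x \<in> carrier R \<Longrightarrow> x \<otimes> e \<oplus> x \<otimes> f = x"
  by (simp flip: r_distr add: e_add_f)

lemma left_decomposition: "x \<in> carrier R \<Longrightarrow> e \<otimes> x \<oplus> f \<otimes> x = x"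
  by (simp flip: l_distr add: e_add_f)

definition ann :: "'a \<Rightarrow> 'a set" where
  "ann w = {x \<in> carrier R. x \<otimes> w = \<zero>}"

text \<open>Right multiplication by \<open>w\<close> maps \<open>R\<close> onto the simple module
  \<open>Re\<close>, with kernel \<open>ann w\<close>.\<close>

lemma maximal_ann:
  assumes w: "w \<in> carrier R" "w \<otimes> e = w" "w \<noteq> \<zero>"
  shows "maximal_left_ideal (ann w) R"
proof (rule maximal_left_idealI)
  show "left_ideal (ann w) R"
    using w(1) by (intro left_idealI) (auto simp: ann_def l_distr m_assoc)
  show "\<one> \<notin> ann w" using w by (simp add: ann_def)
next
  fix x assume x: "x \<in> carrier R" "x \<notin> ann w"
  have "(x \<otimes> w) \<otimes> e = x \<otimes> w" using x w(1) by (simp only: m_assoc e_closed w(2))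
  moreover have "x \<otimes> w \<noteq> \<zero>" using x by (simp add: ann_def)
  ultimately obtain y where y: "y \<in> carrier R" "y \<otimes> (x \<otimes> w) = e"
    using simple_e[of "x \<otimes> w"] x(1) w(1) by auto
  \<comment> \<open>\<open>y\<close> sends \<open>x \<otimes> w\<close> to \<open>e\<close>, so
    \<open>?z\<close> sends it to \<open>w \<otimes> e = w\<close>, and
    \<open>\<one> \<ominus> ?z \<otimes> x\<close> annihilates \<open>w\<close>.\<close>
  let ?z = "w \<otimes> y"
  have zc: "?z \<in> carrier R" "?z \<otimes> x \<in> carrier R" using w y x by simp_all
  have "(?z \<otimes> x) \<otimes> w = w \<otimes> (y \<otimes> (x \<otimes> w))" using w(1) y(1) x(1) by (simp only: m_assoc m_closed)
  then have zxw: "(?z \<otimes> x) \<otimes> w = w" using y(2) w(2) by simp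
  have "(\<one> \<ominus> ?z \<otimes> x) \<otimes> w = w \<ominus> (?z \<otimes> x) \<otimes> w"
    using zc(2) w(1) by (simp add: minus_eq l_distr l_minus del: m_closed)
  also have "\<dots> = \<zero>" using w(1) unfolding zxw by (simp add: minus_eq r_neg)
  finally have "\<one> \<ominus> ?z \<otimes> x \<in> ann w" using zc(2) by (simp add: ann_def)
  moreover have "\<one> = (\<one> \<ominus> ?z \<otimes> x) \<oplus> ?z \<otimes> x"
    using zc(2) by (simp add: minus_eq a_assoc l_neg del: m_closed)
  ultimately show "\<exists>m\<in>ann w. \<exists>z\<in>carrier R. \<one> = m \<oplus> z \<otimes> x" using zc(1) by blast
qed

text \<open>Schur's lemma for the simple module \<open>Re\<close>, in elements. Simplicity gives
  left inverses of nonzero elements; a left inverse is itself nonzero, and its own left inverse must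
  be the original element.\<close>

lemma division_ring_corner: "Defs.division_ring (corner R e)"
proof -
  interpret D: ring "corner R e" by (rule ring_corner) simp_all
  have inv: "\<exists>y\<in>carrier (corner R e). y \<otimes> x = e"
    if xD: "x \<in> carrier (corner R e)" and nz: "x \<noteq> \<zero>" for x
  proof -
    have x: "x \<in> carrier R" "e \<otimes> x = x" "x \<otimes> e = x" using xD by (auto simp: corner_simps)
    obtain y where y: "y \<in> carrier R" "y \<otimes> x = e"
      using simple_e[of x] x nz by auto
    have "(e \<otimes> y \<otimes> e) \<otimes> x = e \<otimes> (y \<otimes> (e \<otimes> x))" using x(1) y(1) by (simp add: m_assoc)
    also have "\<dots> = e" using x(2) y(2) by simp
    finally have "(e \<otimes> y \<otimes> e) \<otimes> x = e" .
    moreover have "e \<otimes> y \<otimes> e \<in> carrier (corner R e)" using y(1) by (simp add: corner_simps m_assoc)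
    ultimately show ?thesis by blast
  qed
  show ?thesis
  proof (intro division_ring.intro division_ring_axioms.intro D.ring_axioms equalityI subsetI)
    fix x assume "x \<in> Units (corner R e)"
    then obtain y where "x \<in> carrier (corner R e)" "y \<in> carrier (corner R e)" "y \<otimes> x = e"
      by (auto simp: Units_def corner_simps)
    then show "x \<in> carrier (corner R e) - {\<zero>\<^bsub>corner R e\<^esub>}"
      using e_nonzero by (auto simp: corner_simps)
  next
    fix x assume "x \<in> carrier (corner R e) - {\<zero>\<^bsub>corner R e\<^esub>}"
    then have x: "x \<in> carrier (corner R e)" "x \<noteq> \<zero>" by (auto simp: corner_simps)
    obtain y where y: "y \<in> carrier (corner R e)" "y \<otimes> x = e" using inv[OF x] by blast
    then have "y \<noteq> \<zero>" using e_nonzero x by (auto simp: corner_simps)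
    then obtain z where z: "z \<in> carrier (corner R e)" "z \<otimes> y = e" using inv[OF y(1)] by blast
    have "z = x"
      using D.inv_unique[of z y x] x(1) y z by (simp add: corner_simps)
    then show "x \<in> Units (corner R e)"
      using x(1) y z by (auto simp: Units_def corner_simps)
  qed
qed

end

section \<open>Idempotents from two maximal left ideals\<close>

text \<open>Take \<open>\<one> = e \<oplus> f\<close> with \<open>e\<close> in \<open>M\<close> and
  \<open>f\<close> in \<open>N\<close>. For \<open>x\<close> in \<open>M\<close>, the element
  \<open>x \<otimes> f = x \<ominus> x \<otimes> e\<close> lies in both ideals, so it vanishes; this
  and its mirror image give orthogonality and idempotence. \<open>Re\<close> is simple by maximality
  of \<open>N\<close>, because a nonzero \<open>x \<otimes> e\<close> lies in \<open>M\<close> and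
  hence outside \<open>N\<close>.\<close>

lemma (in ring) two_simple_idempotents_if_maximal_Int_zero:
  assumes M: "maximal_left_ideal M R" and N: "maximal_left_ideal N R" and "M \<noteq> N"
    and Int: "M \<inter> N = {\<zero>}"
  obtains e f where "two_simple_idempotents R e f"
proof -
  interpret M: maximal_left_ideal M R by fact
  interpret N: maximal_left_ideal N R by fact
  have "\<not> N \<subseteq> M"
    using N.I_maximal[OF M.left_ideal_axioms _ M.a_subset] \<open>M \<noteq> N\<close> M.notcarrier by blast
  then obtain n where n: "n \<in> N" "n \<notin> M" by blast
  obtain e z where ez: "e \<in> M" "z \<in> carrier R" "\<one> = e \<oplus> z \<otimes> n"
    using M.one_eq_add_mult[OF N.a_Hcarr[OF n(1)] n(2)] by blast
  define f where "f = z \<otimes> n"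
  have fN: "f \<in> N" using N.l_closed[OF n(1) ez(2)] by (simp add: f_def)
  have c: "e \<in> carrier R" "f \<in> carrier R" using ez fN by simp_all
  have ef1: "e \<oplus> f = \<one>" using ez(3) by (simp add: f_def)
  have dec: "x \<otimes> e \<oplus> x \<otimes> f = x" if "x \<in> carrier R" for x
    using that c by (simp flip: r_distr add: ef1)
  have Mf: "x \<otimes> f = \<zero>" if x: "x \<in> M" for x
  proof -
    have xc: "x \<in> carrier R" using x by simp
    have "x \<otimes> f = \<ominus> (x \<otimes> e) \<oplus> (x \<otimes> e \<oplus> x \<otimes> f)"
      using xc c by (simp add: r_neg1)
    also have "\<dots> = \<ominus> (x \<otimes> e) \<oplus> x" using dec[OF xc] by simp
    finally have "x \<otimes> f \<in> M" using M.l_closed[OF ez(1) xc] x by simp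
    then show ?thesis using N.l_closed[OF fN xc] Int by blast
  qed
  have Ne: "x \<otimes> e = \<zero>" if x: "x \<in> N" for x
  proof -
    have xc: "x \<in> carrier R" using x by simp
    have "x \<otimes> e = (x \<otimes> e \<oplus> x \<otimes> f) \<oplus> \<ominus> (x \<otimes> f)"
      using xc c by (simp add: a_assoc r_neg)
    also have "\<dots> = x \<oplus> \<ominus> (x \<otimes> f)" using dec[OF xc] by simp
    finally have "x \<otimes> e \<in> N" using N.l_closed[OF fN xc] x by simp
    then show ?thesis using M.l_closed[OF ez(1) xc] Int by blast
  qed
  have ef: "e \<otimes> f = \<zero>" "f \<otimes> e = \<zero>" using Mf[OF ez(1)] Ne[OF fN] by simp_all
  have idem: "e \<otimes> e = e" "f \<otimes> f = f" using dec[OF c(1)] dec[OF c(2)] ef c by simp_all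
  have ne: "e \<noteq> \<zero>" "f \<noteq> \<zero>"
    using ef1 c ez(1) fN M.one_notin N.one_notin by auto
  have "two_simple_idempotents R e f"
  proof (intro two_simple_idempotents.intro two_simple_idempotents_axioms.intro ring_axioms)
    fix x assume x: "x \<in> carrier R"
    show "\<exists>y\<in>carrier R. y \<otimes> (x \<otimes> e) = e" if ne: "x \<otimes> e \<noteq> \<zero>"
    proof -
      have xe: "x \<otimes> e \<in> carrier R" using x c by simp
      have "x \<otimes> e \<notin> N" using M.l_closed[OF ez(1) x] ne Int by blast
      then obtain m y where my: "m \<in> N" "y \<in> carrier R" "\<one> = m \<oplus> y \<otimes> (x \<otimes> e)"
        using N.one_eq_add_mult[OF xe] by blast
      have "e = \<one> \<otimes> e" using c by simp
      also have "\<dots> = (m \<oplus> y \<otimes> (x \<otimes> e)) \<otimes> e" by (rule arg_cong[OF my(3)])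
      also have "\<dots> = m \<otimes> e \<oplus> y \<otimes> (x \<otimes> e)"
        using N.a_Hcarr[OF my(1)] my(2) x c by (simp add: l_distr m_assoc idem)
      also have "\<dots> = y \<otimes> (x \<otimes> e)" using Ne[OF my(1)] my(2) xe by simp
      finally show ?thesis using my(2) by metis
    qed
    show "\<exists>y\<in>carrier R. y \<otimes> (x \<otimes> f) = f" if ne: "x \<otimes> f \<noteq> \<zero>"
    proof -
      have xf: "x \<otimes> f \<in> carrier R" using x c by simp
      have "x \<otimes> f \<notin> M" using N.l_closed[OF fN x] ne Int by blast
      then obtain m y where my: "m \<in> M" "y \<in> carrier R" "\<one> = m \<oplus> y \<otimes> (x \<otimes> f)"
        using M.one_eq_add_mult[OF xf] by blast
      have "f = \<one> \<otimes> f" using c by simp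
      also have "\<dots> = (m \<oplus> y \<otimes> (x \<otimes> f)) \<otimes> f" by (rule arg_cong[OF my(3)])
      also have "\<dots> = m \<otimes> f \<oplus> y \<otimes> (x \<otimes> f)"
        using M.a_Hcarr[OF my(1)] my(2) x c by (simp add: l_distr m_assoc idem)
      also have "\<dots> = y \<otimes> (x \<otimes> f)" using Mf[OF my(1)] my(2) xf by simp
      finally show ?thesis using my(2) by metis
    qed
  qed (use c ef idem ne ef1 in auto)
  then show ?thesis by (rule that)
qed

section \<open>The product of two division rings\<close>

locale decomposed = two_simple_idempotents +
  assumes eRf: "\<And>x. x \<in> carrier R \<Longrightarrow> e \<otimes> (x \<otimes> f) = \<zero>"
    and fRe: "\<And>x. x \<in> carrier R \<Longrightarrow> f \<otimes> (x \<otimes> e) = \<zero>"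
begin

text \<open>Both sides equal \<open>exe\<close>, because the off-diagonal Peirce components
  vanish.\<close>

lemma e_central: "x \<in> carrier R \<Longrightarrow> e \<otimes> x = x \<otimes> e"
  using right_decomposition[of "e \<otimes> x"] left_decomposition[of "x \<otimes> e"] eRf fRe
  by (simp add: m_assoc)

lemma f_central: "x \<in> carrier R \<Longrightarrow> f \<otimes> x = x \<otimes> f"
  using right_decomposition[of "f \<otimes> x"] left_decomposition[of "x \<otimes> f"] eRf fRe
  by (simp add: m_assoc)

lemma mult_e_f: "x \<in> carrier R \<Longrightarrow> x \<otimes> e \<otimes> f = \<zero>" "x \<in> carrier R \<Longrightarrow> x \<otimes> f \<otimes> e = \<zero>"
  by (simp_all add: m_assoc)

lemma iso_RDirProd: "R \<simeq> RDirProd (corner R e) (corner R f)"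
proof -
  let ?h = "\<lambda>x. (x \<otimes> e, x \<otimes> f)"
  have carr: "carrier (RDirProd (corner R e) (corner R f)) = carrier (corner R e) \<times> carrier (corner R f)"
    by (rule RDirProd_carrier)
  have "?h \<in> ring_iso R (RDirProd (corner R e) (corner R f))"
  proof (rule ring_iso_memI)
    show closed: "?h x \<in> carrier (RDirProd (corner R e) (corner R f))" if "x \<in> carrier R" for x
      using that e_central[of "x \<otimes> e"] f_central[of "x \<otimes> f"] by (simp add: carr corner_simps m_assoc)
    show "?h (x \<otimes> y) = ?h x \<otimes>\<^bsub>RDirProd (corner R e) (corner R f)\<^esub> ?h y"
      if xy: "x \<in> carrier R" "y \<in> carrier R" for x y
    proof -
      have "x \<otimes> e \<otimes> (y \<otimes> e) = x \<otimes> (e \<otimes> y) \<otimes> e" using xy by (simp add: m_assoc)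
      also have "\<dots> = x \<otimes> y \<otimes> e" using xy by (simp add: e_central m_assoc)
      finally have 1: "x \<otimes> y \<otimes> e = x \<otimes> e \<otimes> (y \<otimes> e)" by simp
      have "x \<otimes> f \<otimes> (y \<otimes> f) = x \<otimes> (f \<otimes> y) \<otimes> f" using xy by (simp add: m_assoc)
      also have "\<dots> = x \<otimes> y \<otimes> f" using xy by (simp add: f_central m_assoc)
      finally have 2: "x \<otimes> y \<otimes> f = x \<otimes> f \<otimes> (y \<otimes> f)" by simp
      show ?thesis using 1 2 by (simp add: RDirProd_def DirProd_def monoid.defs corner_simps)
    qed
    show "?h (x \<oplus> y) = ?h x \<oplus>\<^bsub>RDirProd (corner R e) (corner R f)\<^esub> ?h y"
      if "x \<in> carrier R" "y \<in> carrier R" for x y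
      using that by (simp add: RDirProd_def DirProd_def monoid.defs corner_simps l_distr)
    show "?h \<one> = \<one>\<^bsub>RDirProd (corner R e) (corner R f)\<^esub>"
      by (simp add: RDirProd_def DirProd_def monoid.defs corner_simps)
    show "bij_betw ?h (carrier R) (carrier (RDirProd (corner R e) (corner R f)))"
    proof (rule bij_betw_imageI)
      show "inj_on ?h (carrier R)"
        by (rule inj_onI) (metis prod.inject right_decomposition)
      show "?h ` carrier R = carrier (RDirProd (corner R e) (corner R f))"
      proof (intro equalityI subsetI)
        fix p assume "p \<in> carrier (RDirProd (corner R e) (corner R f))"
        then obtain x y where p: "p = (x, y)"
          and x: "x \<in> carrier R" "x \<otimes> e = x" and y: "y \<in> carrier R" "y \<otimes> f = y"
          by (auto simp: carr corner_simps)
        have "x \<otimes> f = \<zero>" "y \<otimes> e = \<zero>"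
          using mult_e_f(1)[OF x(1)] mult_e_f(2)[OF y(1)] x(2) y(2) by simp_all
        then have "p = ?h (x \<oplus> y)" using p x y by (simp add: l_distr)
        then show "p \<in> ?h ` carrier R" using x y by blast
      qed (use closed in auto)
    qed
  qed
  then show ?thesis by (auto simp: is_ring_iso_def)
qed

text \<open>A left ideal that \<open>e\<close> does not annihilate contains some
  \<open>t \<otimes> e = e \<otimes> t \<noteq> \<zero>\<close> by centrality, hence
  \<open>e\<close> by simplicity, hence \<open>Re\<close>, which is \<open>ann f\<close>.\<close>

lemma max_left_ideals_eq: "max_left_ideals R = {ann e, ann f}"
proof -
  interpret swap: two_simple_idempotents R f e by (rule swap)
  have me: "maximal_left_ideal (ann e) R" by (rule maximal_ann) (simp_all add: e_nonzero)
  have mf: "maximal_left_ideal (ann f) R"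
    using swap.maximal_ann[of f] f_nonzero by (simp add: ann_def swap.ann_def)
  have "L = ann e \<or> L = ann f" if L: "maximal_left_ideal L R" for L
  proof (cases "L \<subseteq> ann e")
    case True
    then have "ann e = L \<or> ann e = carrier R"
      using maximal_left_ideal.I_maximal[OF L maximal_left_ideal.axioms(1)[OF me]]
      by (auto simp: ann_def)
    then show ?thesis using maximal_left_ideal.notcarrier[OF me] by blast
  next
    case False
    interpret L: maximal_left_ideal L R by fact
    obtain t where t: "t \<in> L" "t \<otimes> e \<noteq> \<zero>" using False by (auto simp: ann_def)
    have tc: "t \<in> carrier R" using t by simp
    obtain y where y: "y \<in> carrier R" "y \<otimes> (t \<otimes> e) = e" using simple_e[OF tc t(2)] by blast
    have "t \<otimes> e \<in> L" using L.l_closed[OF t(1) e_closed] e_central[OF tc] by simp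
    then have eL: "e \<in> L" using L.l_closed[OF _ y(1)] y(2) by metis
    have "ann f \<subseteq> L"
    proof
      fix x assume "x \<in> ann f"
      then have x: "x \<in> carrier R" "x \<otimes> f = \<zero>" by (auto simp: ann_def)
      then have "x = x \<otimes> e" using right_decomposition[OF x(1)] by simp
      then show "x \<in> L" using L.l_closed[OF eL x(1)] by simp
    qed
    then have "L = ann f \<or> L = carrier R"
      using maximal_left_ideal.I_maximal[OF mf L.left_ideal_axioms] L.a_subset by blast
    then show ?thesis using L.notcarrier by blast
  qed
  then show ?thesis using me mf by (auto simp: max_left_ideals_def)
qed

lemma card_max_left_ideals: "card (max_left_ideals R) = 2"
proof -
  have "e \<in> ann f" "e \<notin> ann e" using e_nonzero by (simp_all add: ann_def)
  then have "ann e \<noteq> ann f" by blast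
  then show ?thesis by (simp add: max_left_ideals_eq)
qed

end

section \<open>The ring of two by two matrices\<close>

text \<open>Here \<open>e, a, b, f\<close> are the matrix units with indices 11, 12, 21, 22.\<close>

locale matrix_units = two_simple_idempotents +
  fixes a b
  assumes a_closed [simp]: "a \<in> carrier R" and b_closed [simp]: "b \<in> carrier R"
    and ea [simp]: "e \<otimes> a = a" and af [simp]: "a \<otimes> f = a"
    and fb [simp]: "f \<otimes> b = b" and be [simp]: "b \<otimes> e = b"
    and ab [simp]: "a \<otimes> b = e" and ba [simp]: "b \<otimes> a = f"
begin

lemma ae [simp]: "a \<otimes> e = \<zero>"
proof -
  have "a \<otimes> e = a \<otimes> f \<otimes> e" by simp
  then show ?thesis by (simp add: m_assoc del: af)
qed

lemma bf [simp]: "b \<otimes> f = \<zero>"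
proof -
  have "b \<otimes> f = b \<otimes> e \<otimes> f" by simp
  then show ?thesis by (simp add: m_assoc del: be)
qed

lemma eb [simp]: "e \<otimes> b = \<zero>"
proof -
  have "e \<otimes> b = e \<otimes> (f \<otimes> b)" by simp
  then show ?thesis by (simp flip: m_assoc del: fb)
qed

lemma unit_assoc [simp]:
  assumes "x \<in> carrier R"
  shows "e \<otimes> (a \<otimes> x) = a \<otimes> x" "a \<otimes> (b \<otimes> x) = e \<otimes> x" "b \<otimes> (a \<otimes> x) = f \<otimes> x"
    "b \<otimes> (e \<otimes> x) = b \<otimes> x" "a \<otimes> (e \<otimes> x) = \<zero>" "e \<otimes> (b \<otimes> x) = \<zero>"
    "f \<otimes> (b \<otimes> x) = b \<otimes> x" "a \<otimes> (f \<otimes> x) = a \<otimes> x"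
  using assms by (simp_all flip: m_assoc)

text \<open>The matrix units of the first row and, in \<open>col\<close>, of the first column, with
  indices counted from zero. Thus \<open>row i \<otimes> x \<otimes> col j\<close> is the entry
  \<open>(i, j)\<close> of \<open>x\<close>, moved into \<open>eRe\<close>.\<close>

definition row :: "nat \<Rightarrow> 'a" where "row i = (if i = 0 then e else a)"
definition col :: "nat \<Rightarrow> 'a" where "col i = (if i = 0 then e else b)"

lemma row_col_closed [simp]: "row i \<in> carrier R" "col i \<in> carrier R"
  by (simp_all add: row_def col_def)

lemma row_mult_col:
  assumes "i < 2" "j < 2"
  shows "row i \<otimes> col j = (if i = j then e else \<zero>)"
  using assms by (auto simp: row_def col_def less_2_cases_iff)

lemma col_mult_row_sum: "col 0 \<otimes> row 0 \<oplus> col 1 \<otimes> row 1 = \<one>"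
  by (simp add: row_def col_def e_add_f)

lemma entry_mem_corner: "x \<in> carrier R \<Longrightarrow> row i \<otimes> x \<otimes> col j \<in> carrier (corner R e)"
  by (simp add: corner_simps row_def col_def m_assoc)

lemma iso_matrix_ring: "R \<simeq> matrix_ring 2 (corner R e)"
proof -
  let ?D = "corner R e" and ?M = "matrix_ring 2 (corner R e)" and ?I = "{..<2::nat}"
  interpret D: ring ?D by (rule ring_corner) simp_all
  have sum2: "(\<Oplus>\<^bsub>?D\<^esub>k\<in>?I. g k) = g 0 \<oplus> g 1" if "g 0 \<in> carrier ?D" "g 1 \<in> carrier ?D" for g
  proof -
    have I: "?I = insert 0 {1}" by auto
    show ?thesis unfolding I using that by (simp add: corner_simps)
  qed
  define h where "h = (\<lambda>x. \<lambda>(i, j) \<in> ?I \<times> ?I. row i \<otimes> x \<otimes> col j)"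
  \<comment> \<open>The sum of all \<open>col i \<otimes> A (i, j) \<otimes> row j\<close> moves the
    entries back. Writing \<open>\<one>\<close> as
    \<open>col 0 \<otimes> row 0 \<oplus> col 1 \<otimes> row 1\<close> between two factors shows
    that \<open>h\<close> is multiplicative, and writing it on both sides of \<open>x\<close> shows
    \<open>g (h x) = x\<close>.\<close>
  define g where "g = (\<lambda>A :: nat \<times> nat \<Rightarrow> 'a.
    (col 0 \<otimes> A (0, 0) \<otimes> row 0 \<oplus> col 0 \<otimes> A (0, 1) \<otimes> row 1) \<oplus>
    (col 1 \<otimes> A (1, 0) \<otimes> row 0 \<oplus> col 1 \<otimes> A (1, 1) \<otimes> row 1))"
  have h_apply: "h x (i, j) = row i \<otimes> x \<otimes> col j" if "i < 2" "j < 2" for x i j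
    using that by (simp add: h_def)
  have closed: "h x \<in> carrier ?M" if "x \<in> carrier R" for x
    using that entry_mem_corner unfolding matrix_ring_def h_def by (simp add: PiE_iff split_beta)
  have "h \<in> ring_iso R ?M"
  proof (rule ring_iso_memI)
    show "h x \<in> carrier ?M" if "x \<in> carrier R" for x using closed[OF that] .
    show "h (x \<otimes> y) = h x \<otimes>\<^bsub>?M\<^esub> h y" if xy: "x \<in> carrier R" "y \<in> carrier R" for x y
    proof (rule ext, clarify)
      fix i j :: nat
      show "h (x \<otimes> y) (i, j) = (h x \<otimes>\<^bsub>?M\<^esub> h y) (i, j)"
      proof (cases "i < 2 \<and> j < 2")
        case True
        have "(h x \<otimes>\<^bsub>?M\<^esub> h y) (i, j) = (\<Oplus>\<^bsub>?D\<^esub>k\<in>?I. h x (i, k) \<otimes> h y (k, j))"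
          using True by (simp add: matrix_ring_def corner_simps)
        also have "\<dots> = h x (i, 0) \<otimes> h y (0, j) \<oplus> h x (i, 1) \<otimes> h y (1, j)"
          using True D.m_closed[OF entry_mem_corner[OF xy(1)] entry_mem_corner[OF xy(2)]]
          by (intro sum2) (simp_all add: h_apply corner_simps(2))
        also have "\<dots> = row i \<otimes> x \<otimes> (col 0 \<otimes> row 0 \<oplus> col 1 \<otimes> row 1) \<otimes> (y \<otimes> col j)"
          using True xy by (simp add: h_apply l_distr r_distr m_assoc)
        also have "\<dots> = h (x \<otimes> y) (i, j)"
          unfolding col_mult_row_sum using True xy by (simp add: h_apply m_assoc)
        finally show ?thesis by simp
      next
        case False
        then show ?thesis by (auto simp: h_def matrix_ring_def)
      qed
    qed
    show "h (x \<oplus> y) = h x \<oplus>\<^bsub>?M\<^esub> h y" if xy: "x \<in> carrier R" "y \<in> carrier R" for x y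
      using xy by (auto simp: h_def matrix_ring_def corner_simps l_distr r_distr)
    show "h \<one> = \<one>\<^bsub>?M\<^esub>"
      using row_mult_col by (auto simp: h_def matrix_ring_def corner_simps)
    show "bij_betw h (carrier R) (carrier ?M)"
    proof (rule bij_betwI[where g = g])
      show "h \<in> carrier R \<rightarrow> carrier ?M" using closed by blast
      have entry: "A (i, j) \<in> carrier R \<and> e \<otimes> A (i, j) = A (i, j) \<and> A (i, j) \<otimes> e = A (i, j)"
        if "A \<in> carrier ?M" "i < 2" "j < 2" for A i j
        using that by (auto simp: matrix_ring_def corner_simps PiE_iff)
      then show "g \<in> carrier ?M \<rightarrow> carrier R" by (auto simp: g_def)
      show "g (h x) = x" if x: "x \<in> carrier R" for x
      proof -
        have "g (h x) = (col 0 \<otimes> row 0 \<oplus> col 1 \<otimes> row 1) \<otimes> x \<otimes> (col 0 \<otimes> row 0 \<oplus> col 1 \<otimes> row 1)"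
          using x by (simp add: g_def h_apply l_distr r_distr m_assoc a_ac)
        then show ?thesis unfolding col_mult_row_sum using x by simp
      qed
      show "h (g A) = A" if A: "A \<in> carrier ?M" for A
      proof (rule ext, clarify)
        fix i j :: nat
        show "h (g A) (i, j) = A (i, j)"
        proof (cases "i < 2 \<and> j < 2")
          case True
          have c: "A (k, l) \<in> carrier R" "e \<otimes> A (k, l) = A (k, l)" "A (k, l) \<otimes> e = A (k, l)"
            if "k < 2" "l < 2" for k l
            using entry[OF A that] by simp_all
          note c01 = c[of 0 0] c[of 0 1] c[of 1 0] c[of 1 1]
          have "(row i \<otimes> col k) \<otimes> A (k, l) \<otimes> (row l \<otimes> col j) =
              (if k = i \<and> l = j then A (k, l) else \<zero>)" if "k < 2" "l < 2" for k l
            using True that c[OF that] by (cases "k = i"; cases "l = j") (simp_all add: row_mult_col)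
          note u = this[of 0 0] this[of 0 1] this[of 1 0] this[of 1 1]
          have "h (g A) (i, j) =
            ((row i \<otimes> col 0) \<otimes> A (0, 0) \<otimes> (row 0 \<otimes> col j) \<oplus> (row i \<otimes> col 0) \<otimes> A (0, 1) \<otimes> (row 1 \<otimes> col j)) \<oplus>
            ((row i \<otimes> col 1) \<otimes> A (1, 0) \<otimes> (row 0 \<otimes> col j) \<oplus> (row i \<otimes> col 1) \<otimes> A (1, 1) \<otimes> (row 1 \<otimes> col j))"
            using True c01(1,4,7,10) by (simp add: g_def h_apply l_distr r_distr m_assoc)
          also have "\<dots> = A (i, j)"
            using True c01(1,4,7,10) u by (auto simp: less_2_cases_iff)
          finally show ?thesis .
        next
          case False
          \<comment> \<open>Outside the index range both functions take the default value of
            extensional functions.\<close>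
          then have "A (i, j) = undefined" using A by (auto simp: matrix_ring_def PiE_iff extensional_def)
          then show ?thesis using False by (auto simp: h_def)
        qed
      qed
    qed
  qed
  then show ?thesis by (auto simp: is_ring_iso_def)
qed

text \<open>Maximal left ideals correspond to points of the projective line over the corner ring, with
  \<open>None\<close> at infinity.\<close>

definition point :: "'a option \<Rightarrow> 'a" where
  "point p = (case p of None \<Rightarrow> b | Some y \<Rightarrow> e \<oplus> b \<otimes> y)"

text \<open>In the first column, \<open>point None\<close> is the vector \<open>(0, 1)\<close> and
  \<open>point (Some y)\<close> is \<open>(1, y)\<close>; a maximal left ideal consists of the
  matrices that kill one such vector. A nonzero first row \<open>(p, q)\<close> in the ideal
  determines the vector: it kills \<open>(0, 1)\<close> if \<open>q = 0\<close>, and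
  \<open>(1, y)\<close> with \<open>y\<close> the negative of the inverse of \<open>q\<close> times
  \<open>p\<close> otherwise.\<close>

lemma bij_betw_points:
  "bij_betw (\<lambda>p. ann (point p)) (insert None (Some ` carrier (corner R e))) (max_left_ideals R)"
proof (rule bij_betw_imageI)
  have D: "y \<in> carrier R" "e \<otimes> y = y" "y \<otimes> e = y" if "y \<in> carrier (corner R e)" for y
    using that by (auto simp: corner_simps)
  have point_Some: "e \<otimes> point (Some y) = e" "a \<otimes> point (Some y) = y"
    "point (Some y) \<in> carrier R" "point (Some y) \<otimes> e = point (Some y)"
    if "y \<in> carrier (corner R e)" for y
    using D[OF that] by (simp_all add: point_def l_distr r_distr m_assoc)
  have max_point: "maximal_left_ideal (ann (point p)) R"
    if "p \<in> insert None (Some ` carrier (corner R e))" for p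
  proof (rule maximal_ann)
    have "b \<noteq> \<zero>" using ab e_nonzero by (metis a_closed r_null)
    moreover have "point (Some y) \<noteq> \<zero>" if "y \<in> carrier (corner R e)" for y
      using point_Some(1)[OF that] e_nonzero by auto
    ultimately show "point p \<noteq> \<zero>" using that by (auto simp: point_def)
    show "point p \<in> carrier R" "point p \<otimes> e = point p"
      using that point_Some by (auto simp: point_def)
  qed
  \<comment> \<open>For injectivity: \<open>a \<ominus> y\<close> sends
    \<open>point (Some z)\<close> to \<open>z \<ominus> y\<close>, so it separates the finite
    points, and \<open>e\<close> kills the point at infinity but no finite one.\<close>
  have sub_mem: "a \<ominus> y \<in> ann (point (Some z)) \<longleftrightarrow> y = z"
    if y: "y \<in> carrier (corner R e)" and z: "z \<in> carrier (corner R e)" for y z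
  proof -
    have "y \<otimes> point (Some z) = (y \<otimes> e) \<otimes> point (Some z)" using D[OF y] by simp
    also have "\<dots> = y \<otimes> (e \<otimes> point (Some z))"
      using D(1)[OF y] point_Some(3)[OF z] by (simp only: m_assoc e_closed)
    also have "\<dots> = y" using D(3)[OF y] point_Some(1)[OF z] by simp
    finally have "(a \<ominus> y) \<otimes> point (Some z) = z \<ominus> y"
      using D[OF y] point_Some[OF z] by (simp add: minus_eq l_distr l_minus)
    then show ?thesis using D[OF y] D[OF z] by (auto simp: ann_def)
  qed
  have e_notin: "e \<notin> ann (point (Some y))" if "y \<in> carrier (corner R e)" for y
    using point_Some(1)[OF that] e_nonzero by (simp add: ann_def)
  have e_in: "e \<in> ann (point None)" by (simp add: ann_def point_def)
  show "inj_on (\<lambda>p. ann (point p)) (insert None (Some ` carrier (corner R e)))"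
  proof (rule inj_onI)
    fix p q assume "p \<in> insert None (Some ` carrier (corner R e))" "q \<in> insert None (Some ` carrier (corner R e))"
      and eq: "ann (point p) = ann (point q)"
    then show "p = q"
      using e_notin e_in sub_mem by (cases p; cases q) auto
  qed
  have "L \<in> (\<lambda>p. ann (point p)) ` insert None (Some ` carrier (corner R e))"
    if L: "maximal_left_ideal L R" for L
  proof -
    interpret L: maximal_left_ideal L R by fact
    have eqI: ?thesis if p: "p \<in> insert None (Some ` carrier (corner R e))" and sub: "ann (point p) \<subseteq> L" for p
    proof -
      have "L = ann (point p) \<or> L = carrier R"
        using maximal_left_ideal.I_maximal[OF max_point[OF p] L.left_ideal_axioms sub L.a_subset] .
      then show ?thesis using L.notcarrier p by blast
    qed
    have "\<not> L \<subseteq> {\<zero>}"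
    proof
      assume "L \<subseteq> {\<zero>}"
      moreover have "maximal_left_ideal (ann b) R" using max_point[of None] by (simp add: point_def)
      moreover have "{\<zero>} \<subseteq> ann b" "ann b \<subseteq> carrier R" by (auto simp: ann_def)
      ultimately have "ann b = L \<or> ann b = carrier R"
        using L.I_maximal[OF maximal_left_ideal.axioms(1)] by blast
      then have "e \<in> L"
        using maximal_left_ideal.notcarrier[OF \<open>maximal_left_ideal (ann b) R\<close>] e_in by (simp add: point_def)
      then show False using \<open>L \<subseteq> {\<zero>}\<close> e_nonzero by blast
    qed
    then obtain s where s: "s \<in> L" "s \<noteq> \<zero>" by blast
    have sc: "s \<in> carrier R" using s by simp
    have "e \<otimes> s \<noteq> \<zero> \<or> a \<otimes> s \<noteq> \<zero>"
    proof (rule ccontr)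
      assume "\<not> ?thesis"
      then have "e \<otimes> s = \<zero>" "b \<otimes> (a \<otimes> s) = \<zero>" by simp_all
      then have "e \<otimes> s = \<zero>" "f \<otimes> s = \<zero>" using sc by simp_all
      then show False using left_decomposition[OF sc] s(2) by simp
    qed
    \<comment> \<open>\<open>e \<otimes> s\<close> is the first row of \<open>s\<close>, and
      \<open>a \<otimes> s\<close> is its second row moved to the first.\<close>
    then obtain t where t: "t \<in> L" "t \<noteq> \<zero>" "e \<otimes> t = t"
      using L.l_closed[OF s(1) e_closed] L.l_closed[OF s(1) a_closed] sc by fastforce
    have tc: "t \<in> carrier R" using t by simp
    define p q where "p = t \<otimes> e" and "q = t \<otimes> b"
    have pq: "p \<in> carrier (corner R e)" "q \<in> carrier (corner R e)"
      using tc t(3) by (simp_all add: p_def q_def corner_simps m_assoc) (simp_all flip: m_assoc)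
    have tpq: "t = p \<oplus> q \<otimes> a"
      using right_decomposition[OF tc] tc by (simp add: p_def q_def m_assoc)
    interpret D: Defs.division_ring "corner R e" by (rule division_ring_corner)
    have inv: "\<exists>w\<in>carrier (corner R e). w \<otimes> x = e" if "x \<in> carrier (corner R e)" "x \<noteq> \<zero>" for x
    proof -
      have "x \<in> Units (corner R e)" using that D.division_ring_Units by (simp add: corner_simps)
      then show ?thesis by (auto simp: Units_def corner_simps)
    qed
    show ?thesis
    proof (cases "q = \<zero>")
      case True
      then have "t = p" using tpq D[OF pq(1)] by simp
      then obtain w where w: "w \<in> carrier (corner R e)" "w \<otimes> t = e" using inv[OF pq(1)] t(2) by blast
      then have eL: "e \<in> L" using L.l_closed[OF t(1)] D[OF w(1)] by metis
      have "ann (point None) \<subseteq> L"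
      proof
        fix x assume "x \<in> ann (point None)"
        then have x: "x \<in> carrier R" "x \<otimes> b = \<zero>" by (auto simp: ann_def point_def)
        have "x \<otimes> f = (x \<otimes> b) \<otimes> a" using x(1) by (simp add: m_assoc)
        then have "x = x \<otimes> e" using right_decomposition[OF x(1)] x by simp
        then show "x \<in> L" using L.l_closed[OF eL x(1)] by simp
      qed
      then show ?thesis by (rule eqI[rotated]) simp
    next
      case False
      then obtain w where w: "w \<in> carrier (corner R e)" "w \<otimes> q = e" using inv[OF pq(2)] by blast
      define y where "y = \<ominus> (w \<otimes> p)"
      have wp: "w \<otimes> p \<in> carrier (corner R e)" using D.m_closed[OF w(1) pq(1)] by (simp add: corner_simps(2))
      have y: "y \<in> carrier (corner R e)"
        using D[OF wp] by (simp add: y_def corner_simps l_minus r_minus)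
      \<comment> \<open>Scaling the row \<open>(p, q)\<close> by the inverse \<open>w\<close> of
        \<open>q\<close> gives the row of \<open>a \<ominus> y\<close>, with second coordinate
        one.\<close>
      have "w \<otimes> t = w \<otimes> p \<oplus> (w \<otimes> q) \<otimes> a"
        unfolding tpq using D[OF w(1)] D[OF pq(1)] D[OF pq(2)] by (simp add: r_distr m_assoc)
      also have "\<dots> = a \<ominus> y"
        using w(2) D[OF wp] by (simp add: y_def minus_eq a_comm)
      finally have ay: "a \<ominus> y \<in> L" using L.l_closed[OF t(1), of w] D[OF w(1)] by simp
      have "ann (point (Some y)) \<subseteq> L"
      proof
        fix x assume "x \<in> ann (point (Some y))"
        then have x: "x \<in> carrier R" "x \<otimes> point (Some y) = \<zero>" by (auto simp: ann_def)
        have yc: "y \<in> carrier R" using D[OF y] by simp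
        have "x \<otimes> e \<oplus> x \<otimes> b \<otimes> y = \<zero>"
          using x yc by (simp add: point_def r_distr m_assoc)
        then have xe: "x \<otimes> e = \<ominus> (x \<otimes> b \<otimes> y)"
          using x(1) yc by (simp add: minus_equality)
        have "x = x \<otimes> e \<oplus> x \<otimes> b \<otimes> a"
          using right_decomposition[OF x(1)] x(1) by (simp add: m_assoc)
        also have "\<dots> = (x \<otimes> b) \<otimes> (a \<ominus> y)"
          unfolding xe using x(1) yc by (simp add: minus_eq r_distr r_minus a_comm)
        finally show "x \<in> L" using L.l_closed[OF ay, of "x \<otimes> b"] x(1) by simp
      qed
      then show ?thesis by (rule eqI[rotated]) (use y in simp)
    qed
  qed
  then show "(\<lambda>p. ann (point p)) ` insert None (Some ` carrier (corner R e)) = max_left_ideals R"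
    using max_point by (auto simp: max_left_ideals_def)
qed

end

text \<open>Simplicity of \<open>Rf\<close> provides \<open>b\<close> with
  \<open>b \<otimes> a = f\<close>. Then \<open>a \<otimes> b\<close> is a nonzero idempotent of the
  division ring \<open>eRe\<close>, and the only one is \<open>e\<close>.\<close>

lemma (in two_simple_idempotents) matrix_units_if_nonzero:
  assumes x: "x \<in> carrier R" "e \<otimes> (x \<otimes> f) \<noteq> \<zero>"
  obtains a b where "matrix_units R e f a b"
proof -
  define a where "a = e \<otimes> (x \<otimes> f)"
  have a: "a \<in> carrier R" "e \<otimes> a = a" "a \<otimes> f = a" using x(1) by (simp_all add: a_def m_assoc)
  obtain y where y: "y \<in> carrier R" "y \<otimes> a = f"
    using simple_f[of a] a x(2) by (auto simp: a_def[symmetric])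
  define b where "b = f \<otimes> (y \<otimes> e)"
  have b: "b \<in> carrier R" "f \<otimes> b = b" "b \<otimes> e = b" using y(1) by (simp_all add: b_def m_assoc)
  have ba: "b \<otimes> a = f"
  proof -
    have "b \<otimes> a = f \<otimes> (y \<otimes> (e \<otimes> a))" using a(1) y(1) by (simp add: b_def m_assoc del: a)
    then show ?thesis by (simp add: a(2) y(2))
  qed
  have ab: "a \<otimes> b \<in> carrier (corner R e)"
  proof -
    have "e \<otimes> (a \<otimes> b) = (e \<otimes> a) \<otimes> b" "(a \<otimes> b) \<otimes> e = a \<otimes> (b \<otimes> e)"
      using a(1) b(1) by (simp_all only: m_assoc e_closed)
    then show ?thesis using a b by (simp add: corner_simps)
  qed
  have aba: "a \<otimes> b \<otimes> a = a" using a b(1) ba by (simp add: m_assoc)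
  then have "a \<otimes> b \<noteq> \<zero>" using a(1) x(2) by (auto simp: a_def[symmetric])
  moreover have "Units (corner R e) = carrier (corner R e) - {\<zero>}"
    using division_ring.division_ring_Units[OF division_ring_corner] by (simp add: corner_simps)
  ultimately have "a \<otimes> b \<in> Units (corner R e)"
    using ab by blast
  then obtain w where w: "w \<in> carrier R" "w \<otimes> (a \<otimes> b) = e" by (auto simp: Units_def corner_simps)
  have "a \<otimes> b = e \<otimes> (a \<otimes> b)" using ab by (simp add: corner_simps)
  also have "\<dots> = w \<otimes> (a \<otimes> b) \<otimes> (a \<otimes> b)" using w by simp
  also have "\<dots> = w \<otimes> (a \<otimes> b \<otimes> a \<otimes> b)" using a(1) b(1) w(1) by (simp add: m_assoc)
  also have "\<dots> = e" using aba w by simp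
  finally have "a \<otimes> b = e" .
  then have "matrix_units R e f a b"
    using a b ba two_simple_idempotents_axioms
    by (simp add: matrix_units_def matrix_units_axioms_def)
  then show ?thesis by (rule that)
qed

section \<open>Values of cyclotomic polynomials\<close>

text \<open>Integrality is a predicate on complex polynomials because the linear factors of
  cyclotomic polynomials exist only there, while divisibility needs integer values.\<close>

definition int_coeffs :: "complex poly \<Rightarrow> bool" where
  "int_coeffs p \<longleftrightarrow> (\<forall>i. poly.coeff p i \<in> \<int>)"

lemma int_coeffs_1: "int_coeffs 1"
  by (simp add: int_coeffs_def coeff_1)

lemma int_coeffs_diff: "int_coeffs p \<Longrightarrow> int_coeffs q \<Longrightarrow> int_coeffs (p - q)"
  by (simp add: int_coeffs_def)

lemma int_coeffs_mult: "int_coeffs p \<Longrightarrow> int_coeffs q \<Longrightarrow> int_coeffs (p * q)"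
  by (auto simp: int_coeffs_def coeff_mult intro!: Ints_sum Ints_mult)

lemma int_coeffs_monom: "c \<in> \<int> \<Longrightarrow> int_coeffs (Polynomial.monom c n)"
  by (simp add: int_coeffs_def)

lemma int_coeffs_prod: "(\<And>x. x \<in> A \<Longrightarrow> int_coeffs (f x)) \<Longrightarrow> int_coeffs (prod f A)"
  by (induction A rule: infinite_finite_induct) (auto simp: int_coeffs_1 int_coeffs_mult)

lemma int_coeffs_poly:
  assumes "int_coeffs p" "x \<in> \<int>"
  shows "poly p x \<in> \<int>"
  using assms by (auto simp: int_coeffs_def poly_altdef intro!: Ints_sum Ints_mult Ints_power)

text \<open>Long division by a monic polynomial stays within the integers: the leading coefficient
  of \<open>h\<close> is that of \<open>g * h\<close>, and the leading term of \<open>h\<close> can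
  be removed.\<close>

lemma int_coeffs_monic_cofactor:
  assumes "int_coeffs g" "lead_coeff g = 1" "int_coeffs (g * h)"
  shows "int_coeffs h"
  using assms(3)
proof (induction "Polynomial.degree h" arbitrary: h rule: less_induct)
  case less
  show ?case
  proof (cases "h = 0")
    case True
    then show ?thesis by (simp add: int_coeffs_def)
  next
    case False
    define c m where "c = lead_coeff h" and "m = Polynomial.monom c (Polynomial.degree h)"
    have "lead_coeff (g * h) = c"
      using assms(2) by (simp add: lead_coeff_mult c_def)
    with less.prems have c: "c \<in> \<int>"
      unfolding int_coeffs_def by metis
    then have m: "int_coeffs m"
      by (simp add: m_def int_coeffs_monom)
    have "int_coeffs (h - m)"
    \<comment> \<open>Removing the leading term lowers only a positive degree; a constant is its own
      leading term.\<close>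
    proof (cases "Polynomial.degree h = 0")
      case True
      then have "h - m = 0"
        by (intro poly_eqI) (auto simp: m_def c_def coeff_eq_0)
      then show ?thesis by (simp add: int_coeffs_def)
    next
      case deg: False
      have "Polynomial.degree (h - m) < Polynomial.degree h"
      proof (rule degree_lessI)
        show "h - m \<noteq> 0 \<or> Polynomial.degree h > 0" using deg by simp
        show "\<forall>k\<ge>Polynomial.degree h. poly.coeff (h - m) k = 0"
          by (auto simp: m_def c_def coeff_eq_0)
      qed
      moreover have "int_coeffs (g * (h - m))"
        using less.prems assms(1) m
        by (simp add: right_diff_distrib int_coeffs_diff int_coeffs_mult)
      ultimately show ?thesis
        using less.hyps by blast
    qed
    moreover have "poly.coeff h i = poly.coeff (h - m) i + poly.coeff m i" for i
      by simp
    ultimately show ?thesis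
      using m unfolding int_coeffs_def by (metis Ints_add)
  qed
qed

section \<open>Cyclotomic polynomials\<close>

definition primitive_roots :: "nat \<Rightarrow> complex set" where
  "primitive_roots n = {z. z ^ n = 1 \<and> (\<forall>k. 0 < k \<and> k < n \<longrightarrow> z ^ k \<noteq> 1)}"

definition cyclotomic :: "nat \<Rightarrow> complex poly" where
  "cyclotomic n = (\<Prod>z\<in>primitive_roots n. [:- z, 1:])"

lemma finite_primitive_roots: "n > 0 \<Longrightarrow> finite (primitive_roots n)"
  by (rule finite_subset[OF _ finite_roots_unity[of n]]) (auto simp: primitive_roots_def)

lemma roots_unity_eq_UN_primitive:
  assumes "n > 0"
  shows "{z::complex. z ^ n = 1} = (\<Union>d\<in>{d. d dvd n}. primitive_roots d)"
proof (intro equalityI subsetI)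
  fix z :: complex assume "z \<in> {z. z ^ n = 1}"
  then have z: "z ^ n = 1" by simp
  define d where "d = (LEAST d. d > 0 \<and> z ^ d = 1)"
  have d: "d > 0 \<and> z ^ d = 1"
    unfolding d_def by (rule LeastI[of _ n]) (use z assms in auto)
  have least: "z ^ k \<noteq> 1" if "0 < k" "k < d" for k
    using not_less_Least[of k "\<lambda>d. d > 0 \<and> z ^ d = 1"] that unfolding d_def by auto
  have "z ^ n = (z ^ d) ^ (n div d) * z ^ (n mod d)"
    by (simp flip: power_mult power_add)
  with z d have "z ^ (n mod d) = 1" by simp
  with least[of "n mod d"] d have "n mod d = 0"
    by (metis mod_less_divisor neq0_conv)
  then show "z \<in> (\<Union>d\<in>{d. d dvd n}. primitive_roots d)"
    using d least by (auto simp: primitive_roots_def)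
next
  fix z assume "z \<in> (\<Union>d\<in>{d. d dvd n}. primitive_roots d)"
  then show "z \<in> {z. z ^ n = 1}"
    by (auto simp: primitive_roots_def power_mult elim!: dvdE)
qed

lemma primitive_roots_disjoint:
  assumes "d > 0" "e > 0" "d \<noteq> e"
  shows "primitive_roots d \<inter> primitive_roots e = {}"
  using assms by (auto simp: primitive_roots_def) (metis linorder_neqE_nat)

text \<open>Both sides are monic of degree \<open>n\<close> and vanish at all \<open>n\<close> roots
  of unity, so a nonzero difference would have more roots than its degree allows.\<close>

lemma prod_roots_unity:
  assumes "n > 0"
  shows "(\<Prod>z | z ^ n = 1. [:- z, 1:]) = Polynomial.monom (1::complex) n - 1"
proof (rule ccontr)
  let ?A = "{z::complex. z ^ n = 1}"
  let ?p = "\<Prod>z\<in>?A. [:- z, 1:]" and ?q = "Polynomial.monom (1::complex) n - 1"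
  assume "?p \<noteq> ?q"
  then have ne: "?p - ?q \<noteq> 0" by simp
  have fin: "finite ?A" and card: "card ?A = n"
    using assms finite_roots_unity[of n] card_roots_unity_eq[of n] by auto
  have degp: "Polynomial.degree ?p = n"
    using card by (simp add: degree_prod_eq_sum_degree)
  have lcp: "poly.coeff ?p n = 1"
    using degp lead_coeff_prod[of "\<lambda>z. [:- z, 1:]" ?A] by simp
  have "Polynomial.degree (?p - ?q) < n"
  proof (rule degree_lessI)
    show "?p - ?q \<noteq> 0 \<or> n > 0" using ne by simp
    show "\<forall>k\<ge>n. poly.coeff (?p - ?q) k = 0"
      using degp lcp assms by (auto simp: coeff_eq_0 coeff_1 le_less)
  qed
  moreover have "?A \<subseteq> {z. poly (?p - ?q) z = 0}"
    using fin by (auto simp: poly_prod poly_monom)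
  then have "card ?A \<le> card {z. poly (?p - ?q) z = 0}"
    by (intro card_mono poly_roots_finite ne)
  ultimately show False
    using card_poly_roots_bound[OF ne] card by linarith
qed

lemma prod_cyclotomic:
  assumes "n > 0"
  shows "(\<Prod>d | d dvd n. cyclotomic d) = Polynomial.monom 1 n - 1"
proof -
  have "(\<Prod>d | d dvd n. cyclotomic d) = (\<Prod>z\<in>(\<Union>d\<in>{d. d dvd n}. primitive_roots d). [:- z, 1:])"
    unfolding cyclotomic_def
  proof (rule prod.UNION_disjoint[symmetric])
    show "finite {d. d dvd n}" using assms by simp
    show "\<forall>d\<in>{d. d dvd n}. finite (primitive_roots d)"
      using assms by (auto intro!: finite_primitive_roots dvd_pos_nat[OF assms])
    show "\<forall>d\<in>{d. d dvd n}. \<forall>e\<in>{d. d dvd n}. d \<noteq> e \<longrightarrow> primitive_roots d \<inter> primitive_roots e = {}"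
      by (intro ballI impI primitive_roots_disjoint) (auto intro: dvd_pos_nat[OF assms])
  qed
  then show ?thesis
    by (simp add: roots_unity_eq_UN_primitive[OF assms, symmetric] prod_roots_unity assms)
qed

lemma lead_coeff_cyclotomic: "lead_coeff (cyclotomic n) = 1"
  by (simp add: cyclotomic_def lead_coeff_prod)

text \<open>\<open>cyclotomic n\<close> is the cofactor in \<open>X^n - 1\<close> of the product
  over the proper divisors, which is monic and integral by induction.\<close>

lemma int_coeffs_cyclotomic: "n > 0 \<Longrightarrow> int_coeffs (cyclotomic n)"
proof (induction n rule: less_induct)
  case (less n)
  let ?D = "{d. d dvd n} - {n}"
  have "int_coeffs (\<Prod>d\<in>?D. cyclotomic d)"
    using less by (intro int_coeffs_prod less.IH) (auto intro: dvd_pos_nat[OF less.prems] dest: dvd_imp_le)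
  moreover have "lead_coeff (\<Prod>d\<in>?D. cyclotomic d) = 1"
    by (simp only: lead_coeff_prod lead_coeff_cyclotomic prod.neutral_const)
  moreover have "(\<Prod>d\<in>?D. cyclotomic d) * cyclotomic n = Polynomial.monom 1 n - 1"
    using prod_cyclotomic[of n] less.prems prod.remove[of "{d. d dvd n}" n cyclotomic]
    by (simp add: mult.commute)
  then have "int_coeffs ((\<Prod>d\<in>?D. cyclotomic d) * cyclotomic n)"
    by (simp add: int_coeffs_diff int_coeffs_monom int_coeffs_1)
  ultimately show ?case
    using int_coeffs_monic_cofactor by blast
qed

text \<open>Every factor has norm at least \<open>q - 1\<close>, hence at least one, so it suffices
  that a single factor exceeds \<open>q - 1\<close>. A root of norm one other than \<open>1\<close>
  itself has real part below one and provides it; \<open>n \<ge> 2\<close> ensures that one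
  exists.\<close>

lemma norm_cyclotomic_gt:
  assumes "n \<ge> 2" "q \<ge> 2"
  shows "real q - 1 < norm (poly (cyclotomic n) (of_nat q))"
proof -
  define z where "z = cis (2 * pi / n)"
  have zpow: "z ^ k = cis (2 * pi * k / n)" for k
    by (simp add: z_def Complex.DeMoivre mult_ac)
  have z1: "z ^ k \<noteq> 1" if "0 < k" "k < n" for k
  proof
    assume "z ^ k = 1"
    then have "cos (2 * pi * k / n) = 1"
      by (simp add: zpow complex_eq_iff)
    then obtain m :: int where "2 * pi * k / n = of_int m * (2 * pi)"
      by (auto simp: cos_one_2pi_int)
    then have "real k = of_int m * real n"
      using assms by (simp add: field_simps)
    then have "int k = m * int n"
      by (metis (mono_tags) of_int_eq_iff of_int_mult of_int_of_nat_eq)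
    with that show False
      by (metis int_dvd_int_iff dvd_triv_right nat_dvd_not_less)
  qed
  have z: "z \<in> primitive_roots n"
    using z1 assms by (auto simp: primitive_roots_def zpow)
  have norm1: "norm w = 1" if "w \<in> primitive_roots n" for w
  proof -
    have "norm w ^ n = 1" using that by (simp add: primitive_roots_def flip: norm_power)
    then show ?thesis using assms by (intro power_eq_imp_eq_base[of "norm w" n 1]) auto
  qed
  have ge: "real q - 1 \<le> norm (of_nat q - w)" if "w \<in> primitive_roots n" for w
    using norm_triangle_ineq2[of "of_nat q" w] norm1[OF that] by simp
  have zne: "z \<noteq> 1" using z1[of 1] assms by simp
  have gt: "real q - 1 < norm (of_nat q - z)"
  proof -
    have nz: "(Re z)\<^sup>2 + (Im z)\<^sup>2 = 1"
      using norm1[OF z] by (simp add: cmod_def)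
    have "Re z \<noteq> 1" using nz zne by (auto simp: complex_eq_iff)
    moreover have "Re z \<le> 1" using abs_Re_le_cmod[of z] norm1[OF z] by simp
    ultimately have "Re z < 1" by simp
    then have "real q * Re z < real q" using assms by simp
    \<comment> \<open>As \<open>z\<close> has norm one, the right side is
      \<open>q^2 - 2 * q * Re z + 1\<close>.\<close>
    then have "(real q - 1)\<^sup>2 < (norm (of_nat q - z))\<^sup>2"
      using nz unfolding cmod_power2 by (simp add: power2_eq_square algebra_simps)
    then show ?thesis using power_less_imp_less_base norm_ge_zero by blast
  qed
  have "norm (poly (cyclotomic n) (of_nat q)) = (\<Prod>w\<in>primitive_roots n. norm (of_nat q - w))"
    by (simp add: cyclotomic_def poly_prod prod_norm)
  also have "\<dots> = norm (of_nat q - z) * (\<Prod>w\<in>primitive_roots n - {z}. norm (of_nat q - w))"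
    using z assms finite_primitive_roots by (intro prod.remove) auto
  also have "\<dots> \<ge> norm (of_nat q - z) * 1"
  proof (intro mult_left_mono prod_ge_1)
    show "1 \<le> norm (of_nat q - w)" if "w \<in> primitive_roots n - {z}" for w
      using ge[of w] that assms by simp
  qed simp
  finally show ?thesis using gt by simp
qed

text \<open>\<open>c\<close> is the absolute value of \<open>cyclotomic n\<close> at
  \<open>q\<close>. The divisors of \<open>n\<close> split into \<open>n\<close>, the divisors of
  \<open>d\<close> and a rest \<open>E\<close>, so \<open>q^n - 1\<close> is a product of three
  integers, two of which are the value at \<open>n\<close> and \<open>q^d - 1\<close>. Passing to
  the absolute value turns the norm bound into a bound on \<open>c\<close> and keeps
  divisibility.\<close>

lemma cyclotomic_value:
  fixes n q :: nat
  assumes "n \<ge> 2" "q \<ge> 2"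
  obtains c :: int where "c > int q - 1"
    "\<And>d. d dvd n \<Longrightarrow> d < n \<Longrightarrow> c * (int q ^ d - 1) dvd int q ^ n - 1"
proof -
  have val: "poly (prod cyclotomic {d. d dvd m}) (of_nat q) = of_nat q ^ m - 1" if "m > 0" for m
    using that by (simp add: prod_cyclotomic poly_monom)
  have "poly (cyclotomic n) (of_nat q) \<in> \<int>"
    using assms by (intro int_coeffs_poly int_coeffs_cyclotomic) auto
  then obtain c where c: "poly (cyclotomic n) (of_nat q) = of_int c"
    by (rule Ints_cases)
  have "c * (int q ^ d - 1) dvd int q ^ n - 1" if d: "d dvd n" "d < n" for d
  proof -
    have n0: "n > 0" and d0: "d > 0" using assms d by (auto intro: Nat.gr0I)
    define E where "E = {e. e dvd n} - {n} - {e. e dvd d}"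
    have sub: "{e. e dvd d} \<subseteq> {e. e dvd n} - {n}"
    proof
      fix e assume "e \<in> {e. e dvd d}"
      then have "e dvd n" "e \<le> d"
        using d d0 by (auto intro: dvd_trans dvd_imp_le)
      then show "e \<in> {e. e dvd n} - {n}"
        using d by simp
    qed
    have "prod cyclotomic {e. e dvd n} = cyclotomic n * prod cyclotomic ({e. e dvd n} - {n})"
      using n0 by (intro prod.remove) auto
    also have "prod cyclotomic ({e. e dvd n} - {n}) = prod cyclotomic E * prod cyclotomic {e. e dvd d}"
      unfolding E_def using n0 sub by (intro prod.subset_diff) auto
    finally have "(of_nat q ^ n - 1 :: complex) =
        of_int c * (poly (prod cyclotomic E) (of_nat q) * (of_nat q ^ d - 1))"
      using val[OF n0] val[OF d0] c by simp
    moreover have "poly (prod cyclotomic E) (of_nat q) \<in> \<int>"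
      using n0 by (intro int_coeffs_poly int_coeffs_prod int_coeffs_cyclotomic)
        (auto simp: E_def intro: dvd_pos_nat[OF n0])
    then obtain k where "poly (prod cyclotomic E) (of_nat q) = of_int k"
      by (rule Ints_cases)
    ultimately have "(of_int (int q ^ n - 1) :: complex) = of_int (c * (k * (int q ^ d - 1)))"
      by simp
    then have "int q ^ n - 1 = c * (k * (int q ^ d - 1))"
      by (simp only: of_int_eq_iff)
    also have "\<dots> = c * (int q ^ d - 1) * k"
      by (simp only: mult_ac)
    finally show ?thesis by (rule dvdI)
  qed
  moreover have "real q - 1 < \<bar>of_int c\<bar>"
    using norm_cyclotomic_gt[OF assms] by (simp add: c)
  then have "\<bar>c\<bar> > int q - 1" by linarith
  moreover have "\<bar>c\<bar> * k dvd m \<longleftrightarrow> c * k dvd m" for k m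
    by (cases "c \<ge> 0") (simp_all only: abs_of_nonneg abs_of_neg not_le mult_minus_left minus_dvd_iff)
  ultimately show ?thesis
    by (intro that[of "\<bar>c\<bar>"]) blast+
qed

section \<open>Finite division rings\<close>

text \<open>\<open>V\<close> is a vector space over the division ring \<open>K\<close>. Bases are
  avoided: among the subspaces whose size is a power of \<open>card K\<close>, take a largest one
  \<open>W\<close>; a vector \<open>x\<close> outside it would yield the larger
  \<open>W + Kx\<close>, of size \<open>card W * card K\<close>.\<close>

lemma (in ring) card_eq_power_card_scalars:
  assumes K: "additive_subgroup K R" "\<one> \<in> K" "\<one> \<noteq> \<zero>"
    and inv: "\<And>k. k \<in> K \<Longrightarrow> k \<noteq> \<zero> \<Longrightarrow> \<exists>l\<in>K. l \<otimes> k = \<one>"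
    and K_mult: "\<And>k l. k \<in> K \<Longrightarrow> l \<in> K \<Longrightarrow> k \<otimes> l \<in> K"
    and V: "additive_subgroup V R" "finite V"
    and V_smult: "\<And>k v. k \<in> K \<Longrightarrow> v \<in> V \<Longrightarrow> k \<otimes> v \<in> V"
    and KV: "finite K"
  shows "\<exists>m. card V = card K ^ m"
proof -
  interpret K: additive_subgroup K R by fact
  interpret V: additive_subgroup V R by fact
  define S where "S = {W. W \<subseteq> V \<and> additive_subgroup W R \<and>
    (\<forall>k\<in>K. \<forall>v\<in>W. k \<otimes> v \<in> W) \<and> (\<exists>m. card W = card K ^ m)}"
  have "\<exists>m. card {\<zero>} = card K ^ m" by (rule exI[of _ 0]) simp
  moreover have "additive_subgroup {\<zero>} R" by (rule additive_subgroupI2) auto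
  ultimately have "{\<zero>} \<in> S"
    unfolding S_def by (simp del: card.insert)
  moreover have "finite S" using V(2) unfolding S_def by simp
  ultimately obtain W where W: "W \<in> S" and max: "\<And>W'. W' \<in> S \<Longrightarrow> card W' \<le> card W"
    using finite_has_maximal2[of "card ` S" "card {\<zero>}"]
    by (smt (verit, best) finite_imageI image_iff nle_le)
  interpret W: additive_subgroup W R using W unfolding S_def by blast
  have WV: "W \<subseteq> V" and W_smult: "\<And>k v. k \<in> K \<Longrightarrow> v \<in> W \<Longrightarrow> k \<otimes> v \<in> W"
    and finW: "finite W"
    using W V(2) unfolding S_def by (auto intro: finite_subset)
  have "W = V"
  proof (rule ccontr)
    assume "W \<noteq> V"
    then obtain x where x: "x \<in> V" "x \<notin> W" using WV by blast
    then have xc: "x \<in> carrier R" by simp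
    let ?f = "\<lambda>(w, k). w \<oplus> k \<otimes> x"
    let ?W = "?f ` (W \<times> K)"
    have inj: "inj_on ?f (W \<times> K)"
    proof (rule inj_onI; clarify)
      fix w k w' k' assume m: "w \<in> W" "k \<in> K" "w' \<in> W" "k' \<in> K"
        and eq: "w \<oplus> k \<otimes> x = w' \<oplus> k' \<otimes> x"
      have c: "w \<in> carrier R" "k \<in> carrier R" "w' \<in> carrier R" "k' \<in> carrier R"
        using m by simp_all
      have d: "(k \<ominus> k') \<otimes> x = w' \<ominus> w"
      proof -
        have "(k \<ominus> k') \<otimes> x = (w \<oplus> k \<otimes> x) \<ominus> w \<ominus> k' \<otimes> x"
          using c xc by algebra
        also have "\<dots> = w' \<ominus> w"
          unfolding eq using c xc by algebra
        finally show ?thesis .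
      qed
      have "k = k'"
      proof (rule ccontr)
        assume "k \<noteq> k'"
        then have "k \<ominus> k' \<noteq> \<zero>" using c by simp
        moreover have "k \<ominus> k' \<in> K" using m by (simp add: a_minus_def)
        ultimately obtain l where l: "l \<in> K" "l \<otimes> (k \<ominus> k') = \<one>" using inv by blast
        then have "x = l \<otimes> ((k \<ominus> k') \<otimes> x)"
          using c xc by (simp flip: m_assoc)
        also have "\<dots> \<in> W"
          unfolding d using l m by (intro W_smult) (auto simp: a_minus_def)
        finally show False using x by simp
      qed
      then show "w = w' \<and> k = k'" using eq c xc by simp
    qed
    have card: "card ?W = card W * card K"
      using inj by (simp add: card_image card_cartesian_product)
    have "?W \<in> S"
    proof -
      have sub: "?W \<subseteq> V" using WV x V_smult by auto
      moreover have "additive_subgroup ?W R"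
      proof (rule additive_subgroupI2)
        show "?W \<subseteq> carrier R" using sub by auto
        have "\<zero> = ?f (\<zero>, \<zero>)" using xc by simp
        then show "\<zero> \<in> ?W" by (rule image_eqI) simp
      next
        fix u v assume "u \<in> ?W" "v \<in> ?W"
        then obtain w k w' k' where m: "w \<in> W" "k \<in> K" "w' \<in> W" "k' \<in> K"
          and uv: "u = w \<oplus> k \<otimes> x" "v = w' \<oplus> k' \<otimes> x" by auto
        have c: "w \<in> carrier R" "k \<in> carrier R" "w' \<in> carrier R" "k' \<in> carrier R"
          using m by simp_all
        have "u \<oplus> v = ?f (w \<oplus> w', k \<oplus> k')"
          unfolding uv prod.case using c xc by algebra
        then show "u \<oplus> v \<in> ?W" by (rule image_eqI) (use m in simp)
      next
        fix u assume "u \<in> ?W"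
        then obtain w k where m: "w \<in> W" "k \<in> K" and u: "u = w \<oplus> k \<otimes> x" by auto
        have c: "w \<in> carrier R" "k \<in> carrier R" using m by simp_all
        have "\<ominus> u = ?f (\<ominus> w, \<ominus> k)"
          unfolding u prod.case using c xc by algebra
        then show "\<ominus> u \<in> ?W" by (rule image_eqI) (use m in simp)
      qed
      moreover have "k \<otimes> v \<in> ?W" if k: "k \<in> K" and v: "v \<in> ?W" for k v
      proof -
        from v obtain w l where m: "w \<in> W" "l \<in> K" and u: "v = w \<oplus> l \<otimes> x" by auto
        have c: "w \<in> carrier R" "l \<in> carrier R" "k \<in> carrier R" using m k by simp_all
        have "k \<otimes> v = ?f (k \<otimes> w, k \<otimes> l)"
          unfolding u prod.case using c xc by (simp add: r_distr m_assoc)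
        then show ?thesis
          by (rule image_eqI) (use m k W_smult K_mult in simp)
      qed
      moreover obtain m where "card W = card K ^ m" using W unfolding S_def by blast
      then have "card ?W = card K ^ Suc m" by (simp add: card)
      ultimately show ?thesis unfolding S_def by blast
    qed
    then have "card W * card K \<le> card W" using max card by fastforce
    moreover have "card W > 0" using finW W.zero_closed card_gt_0_iff by blast
    moreover have "card {\<zero>, \<one>} \<le> card K"
      using KV K(2) by (intro card_mono) auto
    then have "card K \<ge> 2" using K(3) by simp
    ultimately show False by simp
  qed
  then show ?thesis using W unfolding S_def by blast
qed

text \<open>Modulo \<open>q^d - 1\<close> the power \<open>q^n\<close> depends only on
  \<open>r = n mod d\<close>, and \<open>q^r - 1\<close> with \<open>r < d\<close> is too small to
  be a positive multiple of the modulus.\<close>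

lemma dvd_exponent_if_power_minus_one_dvd:
  fixes q :: nat
  assumes "q \<ge> 2" "int q ^ d - 1 dvd int q ^ n - 1"
  shows "d dvd n"
proof (cases "d = 0")
  case True
  then have "int q ^ n = 1" using assms by simp
  then have "n = 0" using assms one_less_power[of "int q" n] by auto
  then show ?thesis by simp
next
  case False
  define r where "r = n mod d"
  have "[int q ^ d = 1] (mod int q ^ d - 1)"
    by (simp add: cong_iff_dvd_diff)
  then have "[(int q ^ d) ^ (n div d) * int q ^ r = 1 ^ (n div d) * int q ^ r] (mod int q ^ d - 1)"
    by (intro cong_mult cong_pow) auto
  moreover have "(int q ^ d) ^ (n div d) * int q ^ r = int q ^ n"
    by (simp add: r_def flip: power_mult power_add)
  moreover have "[int q ^ n = 1] (mod int q ^ d - 1)"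
    using assms(2) by (simp add: cong_iff_dvd_diff)
  ultimately have "[int q ^ r = 1] (mod int q ^ d - 1)"
    by (metis cong_sym cong_trans mult_1 power_one)
  then have "int q ^ d - 1 dvd int q ^ r - 1"
    by (simp add: cong_iff_dvd_diff)
  moreover have "int q ^ r < int q ^ d"
    using False assms(1) by (intro power_strict_increasing) (auto simp: r_def)
  ultimately have "int q ^ r - 1 \<le> 0"
    using zdvd_imp_le[of "int q ^ d - 1" "int q ^ r - 1"] by linarith
  then have "r = 0"
    using assms(1) one_less_power[of "int q" r] by linarith
  then show ?thesis by (simp add: r_def dvd_eq_mod_eq_0)
qed

section \<open>Centralizers and Wedderburn's little theorem\<close>

text \<open>With a set as parameter, one notion covers the centre, the centralizer of an element
  and, for the empty set, the whole ring; a single count then shows that all their sizes are powers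
  of \<open>q\<close>.\<close>

definition centralizer :: "('a, 'm) ring_scheme \<Rightarrow> 'a set \<Rightarrow> 'a set" where
  "centralizer R A = {c \<in> carrier R. \<forall>x\<in>A. c \<otimes>\<^bsub>R\<^esub> x = x \<otimes>\<^bsub>R\<^esub> c}"

lemma (in ring) additive_subgroup_centralizer:
  assumes "A \<subseteq> carrier R"
  shows "additive_subgroup (centralizer R A) R"
  using assms
  by (intro additive_subgroupI2) (auto simp: centralizer_def l_distr r_distr l_minus r_minus subset_iff)

lemma (in ring) centralizer_mult:
  assumes "A \<subseteq> carrier R" "x \<in> centralizer R A" "y \<in> centralizer R A"
  shows "x \<otimes> y \<in> centralizer R A"
proof -
  have "x \<otimes> y \<otimes> a = a \<otimes> (x \<otimes> y)" if "a \<in> A" for a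
  proof -
    have c: "a \<in> carrier R" "x \<in> carrier R" "y \<in> carrier R" and e: "x \<otimes> a = a \<otimes> x" "y \<otimes> a = a \<otimes> y"
      using assms that by (auto simp: centralizer_def)
    have "x \<otimes> y \<otimes> a = x \<otimes> a \<otimes> y" using c e(2) by (simp add: m_assoc)
    also have "\<dots> = a \<otimes> (x \<otimes> y)" unfolding e(1) using c by (simp add: m_assoc)
    finally show ?thesis .
  qed
  then show ?thesis using assms by (auto simp: centralizer_def)
qed

lemma (in ring) centralizer_inv:
  assumes "A \<subseteq> carrier R" "x \<in> centralizer R A" "x \<in> Units R"
  shows "inv x \<in> centralizer R A"
proof -
  have "inv x \<otimes> a = a \<otimes> inv x" if "a \<in> A" for a
  proof -
    have c: "a \<in> carrier R" "x \<in> carrier R" "inv x \<in> carrier R" and e: "x \<otimes> a = a \<otimes> x"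
      using assms that by (auto simp: centralizer_def)
    have "inv x \<otimes> a = inv x \<otimes> (a \<otimes> x) \<otimes> inv x"
      using c assms(3) by (simp add: m_assoc)
    also have "\<dots> = inv x \<otimes> (x \<otimes> a) \<otimes> inv x" using e by simp
    also have "\<dots> = a \<otimes> inv x"
      using c assms(3) by (simp flip: m_assoc)
    finally show ?thesis .
  qed
  then show ?thesis using assms by (auto simp: centralizer_def)
qed

text \<open>Witt's argument: the value \<open>c\<close> of the cyclotomic polynomial divides the size of every
  noncentral conjugacy class and the order of the unit group, hence also \<open>q - 1 < c\<close>.\<close>

theorem (in Defs.division_ring) finite_division_ring_is_field:
  assumes fin: "finite (carrier R)"
  shows "field R"
proof -
  have "\<one> \<in> Units R" by simp
  then have one: "\<one> \<noteq> \<zero>" using division_ring_Units by blast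
  define Z where "Z = centralizer R (carrier R)"
  define q where "q = card Z"
  have Zc: "Z \<subseteq> carrier R" and finZ: "finite Z"
    using fin by (auto simp: Z_def centralizer_def intro: finite_subset)
  have Z01: "\<zero> \<in> Z" "\<one> \<in> Z" by (auto simp: Z_def centralizer_def)
  have q2: "q \<ge> 2"
    using card_mono[OF finZ, of "{\<zero>, \<one>}"] Z01 one by (simp add: q_def)
  have pow: "\<exists>d. card (centralizer R A) = q ^ d" if A: "A \<subseteq> carrier R" for A
    unfolding q_def
  proof (rule card_eq_power_card_scalars)
    show "additive_subgroup Z R" "additive_subgroup (centralizer R A) R"
      using A additive_subgroup_centralizer by (auto simp: Z_def)
    show "finite (centralizer R A)"
      using fin by (auto simp: centralizer_def)
    show "\<exists>l\<in>Z. l \<otimes> k = \<one>" if "k \<in> Z" "k \<noteq> \<zero>" for k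
    proof -
      have "k \<in> Units R" using that Zc division_ring_Units by blast
      then show ?thesis using that centralizer_inv[of "carrier R" k] Units_l_inv
        unfolding Z_def by blast
    qed
    show "k \<otimes> l \<in> Z" if "k \<in> Z" "l \<in> Z" for k l
      using that centralizer_mult by (auto simp: Z_def)
    show "k \<otimes> v \<in> centralizer R A" if "k \<in> Z" "v \<in> centralizer R A" for k v
      using that A by (intro centralizer_mult) (auto simp: Z_def centralizer_def)
  qed (use Z01 one finZ in auto)
  have "carrier R = centralizer R {}" by (auto simp: centralizer_def)
  with pow[of "{}"] obtain n where n: "card (carrier R) = q ^ n" by auto
  have "Z = carrier R"
  proof (rule ccontr)
    assume "Z \<noteq> carrier R"
    then have "q < q ^ n"
      using psubset_card_mono[OF fin, of Z] Zc by (simp add: n q_def[symmetric] psubset_eq)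
    then have "n \<noteq> 0" "n \<noteq> 1" using q2 by (intro notI; simp)+
    then have n2: "n \<ge> 2" by linarith
    obtain c where c: "c > int q - 1"
      and dvd: "\<And>d. d dvd n \<Longrightarrow> d < n \<Longrightarrow> c * (int q ^ d - 1) dvd int q ^ n - 1"
      using cyclotomic_value[OF n2 q2] by blast
    define G where "G = units_of R"
    define \<phi> where "\<phi> = (\<lambda>g. \<lambda>h \<in> carrier G. g \<otimes>\<^bsub>G\<^esub> h \<otimes>\<^bsub>G\<^esub> inv\<^bsub>G\<^esub> g)"
    interpret G: group G unfolding G_def by (rule units_group)
    interpret act: group_action G "carrier G" \<phi>
      unfolding \<phi>_def by (rule G.action_by_conjugation)
    have Gc: "carrier G = carrier R - {\<zero>}"
      by (simp add: G_def units_of_carrier division_ring_Units)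
    have G_Units: "carrier G = Units R" by (simp add: G_def units_of_carrier)
    have oG: "int (Coset.order G) = int q ^ n - 1"
    proof -
      have "card (carrier R) = Suc (Coset.order G)"
        unfolding Coset.order_def Gc using fin by (metis card_Suc_Diff1 zero_closed)
      then show ?thesis using n by (simp flip: of_nat_power)
    qed
    \<comment> \<open>The stabilizer under conjugation is the centralizer without zero, which is
      where the numbers \<open>q^d - 1\<close> come from.\<close>
    have stab: "stabilizer G \<phi> x = centralizer R {x} - {\<zero>}" if x: "x \<in> carrier G" for x
    proof -
      have "g \<otimes> x \<otimes> inv g = x \<longleftrightarrow> g \<otimes> x = x \<otimes> g" if g: "g \<in> Units R" for g
      proof -
        have xu: "x \<in> carrier R" "g \<in> carrier R" "inv g \<in> carrier R" using x g G_Units by auto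
        have "g \<otimes> x = x \<otimes> g" if "g \<otimes> x \<otimes> inv g = x"
        proof -
          have "g \<otimes> x = g \<otimes> x \<otimes> inv g \<otimes> g" using xu g by (simp add: m_assoc)
          then show ?thesis using that by simp
        qed
        moreover have "g \<otimes> x \<otimes> inv g = x" if "g \<otimes> x = x \<otimes> g"
          using that xu g by (simp add: m_assoc)
        ultimately show ?thesis by blast
      qed
      then have "{g \<in> Units R. g \<otimes> x \<otimes> inv g = x} = {g \<in> Units R. g \<otimes> x = x \<otimes> g}" by blast
      moreover have "stabilizer G \<phi> x = {g \<in> Units R. g \<otimes> x \<otimes> inv g = x}"
        using x by (auto simp: stabilizer_def \<phi>_def G_def units_of_carrier units_of_mult units_of_inv)
      ultimately show ?thesis
        by (auto simp: centralizer_def division_ring_Units)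
    qed
    have orb: "c dvd int (card (orbit G \<phi> x))" if x: "x \<in> carrier R - Z" for x
    proof -
      have xG: "x \<in> carrier G" using x Z01 Gc by blast
      obtain d where d: "card (centralizer R {x}) = q ^ d" using pow[of "{x}"] x by auto
      have cen: "finite (centralizer R {x})" "\<zero> \<in> centralizer R {x}"
        using fin x by (auto simp: centralizer_def)
      have "card (centralizer R {x}) = Suc (card (stabilizer G \<phi> x))"
        unfolding stab[OF xG] using cen by (metis card_Suc_Diff1)
      then have st: "int (card (stabilizer G \<phi> x)) = int q ^ d - 1"
        using d by (simp flip: of_nat_power)
      have os: "int (card (orbit G \<phi> x)) * (int q ^ d - 1) = int q ^ n - 1"
        using arg_cong[OF act.orbit_stabilizer_theorem[OF xG], of int] by (simp add: st oG)
      then have dn: "d dvd n"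
        by (metis dvd_triv_right dvd_exponent_if_power_minus_one_dvd q2)
      have "centralizer R {x} \<noteq> carrier R"
      proof
        assume "centralizer R {x} = carrier R"
        then have "y \<otimes> x = x \<otimes> y" if "y \<in> carrier R" for y
          using that unfolding centralizer_def by blast
        then have "x \<in> Z" using x by (simp add: Z_def centralizer_def)
        then show False using x by simp
      qed
      then have "q ^ d < q ^ n"
        using psubset_card_mono[OF fin, of "centralizer R {x}"] d n
        by (auto simp: centralizer_def)
      then have dlt: "d < n" using q2 by (metis power_less_imp_less_exp Suc_1 Suc_le_eq)
      \<comment> \<open>Zero and one commute with \<open>x\<close>, so \<open>q^d - 1\<close> is
        nonzero and can be cancelled from the orbit equation.\<close>
      have "q ^ d \<ge> 2"
        using card_mono[OF cen(1), of "{\<zero>, \<one>}"] x one d by (auto simp: centralizer_def)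
      then have "int (q ^ d) - 1 \<noteq> 0" by linarith
      then have "int q ^ d - 1 \<noteq> 0" by simp
      moreover have "c * (int q ^ d - 1) dvd int (card (orbit G \<phi> x)) * (int q ^ d - 1)"
        unfolding os by (rule dvd[OF dn dlt])
      ultimately show ?thesis by simp
    qed
    define C where "C = {orbit G \<phi> x | x. x \<in> carrier R - Z}"
    \<comment> \<open>A central element is alone in its orbit, so the orbits of noncentral elements
      avoid \<open>Z\<close> and partition its complement.\<close>
    have phi_Z: "y \<in> Z" if x: "x \<in> carrier G" and y: "y \<in> orbit G \<phi> x" and xZ: "x \<in> Z" for x y
    proof -
      obtain g where g: "g \<in> Units R" "y = g \<otimes> x \<otimes> inv g"
        using y x by (auto simp: orbit_def \<phi>_def G_def units_of_carrier units_of_mult units_of_inv)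
      have "g \<otimes> x = x \<otimes> g" using xZ g by (auto simp: Z_def centralizer_def)
      then have "y = x" using g Units_closed[OF g(1)] subsetD[OF Zc xZ] by (simp add: m_assoc)
      then show ?thesis using xZ by simp
    qed
    have union: "\<Union> C = carrier R - Z"
    proof (intro equalityI subsetI)
      fix y assume "y \<in> \<Union> C"
      then obtain x where x: "x \<in> carrier R - Z" "y \<in> orbit G \<phi> x" unfolding C_def by blast
      have xG: "x \<in> carrier G" using x Z01 Gc by blast
      obtain g where "g \<in> carrier G" "\<phi> g x = y" using x(2) unfolding orbit_def by blast
      then have yG: "y \<in> carrier G" using act.element_image xG by blast
      have "x \<in> orbit G \<phi> y" using act.orbit_sym xG yG x by blast
      then have "y \<notin> Z" using phi_Z[OF yG] x by blast
      then show "y \<in> carrier R - Z" using yG Gc by blast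
    next
      fix x assume x: "x \<in> carrier R - Z"
      then have "x \<in> orbit G \<phi> x" using act.orbit_refl Z01 Gc by blast
      then show "x \<in> \<Union> C" using x unfolding C_def by blast
    qed
    have "nat c dvd card (\<Union> C)"
    proof (rule dvd_partition)
      show "finite (\<Union> C)" unfolding union using fin by simp
      show "\<forall>A\<in>C. nat c dvd card A"
        using orb c q2 by (auto simp: C_def nat_dvd_iff)
      have "C \<subseteq> orbits G (carrier G) \<phi>"
        using Z01 Gc unfolding C_def orbits_def by blast
      then show "\<forall>A\<in>C. \<forall>B\<in>C. A \<noteq> B \<longrightarrow> A \<inter> B = {}"
        using act.disjoint_union by blast
    qed
    then have "c dvd int (card (carrier R - Z))"
      unfolding union using c q2 by (simp add: nat_dvd_iff split: if_splits)
    also have "card (carrier R - Z) = q ^ n - q"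
      using Zc finZ by (simp add: card_Diff_subset n q_def)
    finally have "c dvd int q ^ n - int q"
      using \<open>q < q ^ n\<close> by (simp add: of_nat_diff)
    \<comment> \<open>The divisor \<open>d = 1\<close> of \<open>n\<close> gives this; subtracting
      \<open>q^n - q\<close>, the number of noncentral elements, leaves
      \<open>q - 1\<close>.\<close>
    moreover have "c dvd int q ^ n - 1"
      by (rule dvd_mult_left[OF dvd[of 1]]) (use n2 in auto)
    ultimately have "c dvd (int q ^ n - 1) - (int q ^ n - int q)"
      by (rule dvd_diff[rotated])
    then have "c dvd int q - 1" by simp
    then show False using c q2 zdvd_imp_le[of c "int q - 1"] by simp
  qed
  then have "x \<otimes> y = y \<otimes> x" if "x \<in> carrier R" "y \<in> carrier R" for x y
    using that unfolding Z_def centralizer_def by blast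
  then have "Group.comm_monoid R" by (rule monoid_comm_monoidI)
  then interpret cring R by (rule cring.intro[OF ring_axioms])
  show ?thesis by (rule cring_fieldI[OF division_ring_Units])
qed

section \<open>The order of a finite field\<close>

text \<open>For a prime \<open>p\<close> dividing the order there is
  \<open>x \<noteq> \<zero>\<close> with \<open>p\<close> times \<open>x\<close> zero. This multiple
  is \<open>p\<close> times \<open>\<one>\<close>, multiplied by \<open>x\<close>, so
  \<open>p\<close> is the additive order of \<open>\<one>\<close>. Hence only one prime divides the
  order.\<close>

theorem (in field) primepow_card_finite_field:
  assumes fin: "finite (carrier R)"
  shows "primepow (card (carrier R))"
proof -
  let ?N = "card (carrier R)"
  have N: "?N > 1"
    using card_mono[OF fin, of "{\<zero>, \<one>}"] by simp
  have ord: "add.ord \<one> \<noteq> 1" 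
  proof
    assume "add.ord \<one> = 1"
    then have "add_pow R (1::nat) \<one> = \<zero>" 
      using add.pow_eq_id[OF one_closed, of 1] by simp
    then show False by simp
  qed
  have ord_eq: "add.ord \<one> = p" if p: "Factorial_Ring.prime p" "p dvd ?N" for p :: nat
  proof -
    \<comment> \<open>Sylow's theorem is used with exponent one, where \<open>m\<close> may still be
      divisible by \<open>p\<close>; this is Cauchy's theorem.\<close>
    obtain m where m: "Coset.order (add_monoid R) = p ^ 1 * m"
      using p(2) by (auto simp: Coset.order_def)
    obtain H where H: "subgroup H (add_monoid R)" "card H = p"
      using sylow_thm[OF p(1) a_group m] fin by auto
    have "\<not> H \<subseteq> {\<zero>}"
      using card_mono[of "{\<zero>}" H] H(2) prime_gt_1_nat[OF p(1)] by auto
    then obtain x where x: "x \<in> H" "x \<noteq> \<zero>" by blast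
    have xc: "x \<in> carrier R" using subgroup.subset[OF H(1)] x by auto
    interpret H: group "(add_monoid R)\<lparr>carrier := H\<rparr>"
      using H(1) a_group by (rule subgroup.subgroup_is_group)
    have "x [^]\<^bsub>(add_monoid R)\<lparr>carrier := H\<rparr>\<^esub> p = \<zero>"
      using H.pow_order_eq_1[of x] x H(2) by (simp add: Coset.order_def)
    then have "add_pow R p x = \<zero>"
      by (simp add: add_pow_def nat_pow_def)
    then have "add_pow R p \<one> \<otimes> x = \<zero>"
      using xc by (simp add: add_pow_ldistr)
    then have "add_pow R p \<one> = \<zero>"
      using integral[of _ x] xc x(2) by auto
    then have "add.ord \<one> dvd p" using add.pow_eq_id[of \<one>] by auto
    then show ?thesis using p(1) ord unfolding prime_nat_iff by blast
  qed
  obtain p where p: "Factorial_Ring.prime p" "p dvd ?N"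
    using N prime_factor_nat[of ?N] by (metis less_irrefl)
  have "?N \<noteq> 0" "\<not> is_unit p" using N p(1) by auto
  then obtain k m where m: "?N = p ^ k * m" "\<not> p dvd m"
    by (rule multiplicity_decompose')
  have "m = 1"
  proof (rule ccontr)
    assume "m \<noteq> 1"
    then obtain r where r: "Factorial_Ring.prime r" "r dvd m" using prime_factor_nat[of m] by blast
    then have "r dvd ?N" unfolding m(1) by (intro dvd_mult)
    then have "r = p" using ord_eq[OF p] ord_eq[OF r(1)] by simp
    then show False using r(2) m(2) by simp
  qed
  then have "?N = p ^ k" using m(1) by simp
  moreover from this have "k > 0" using N by (cases k) auto
  ultimately show ?thesis using p(1) unfolding primepow_def by blast
qed

section \<open>Complete multipartite comaximal graphs\<close>

lemma (in matrix_units) finite_corner_field: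
  assumes fin: "finite (max_left_ideals R)"
  shows "field (corner R e)" "finite (carrier (corner R e))" "primepow (card (carrier (corner R e)))"
    "card (max_left_ideals R) = card (carrier (corner R e)) + 1"
proof -
  have "finite (Some ` carrier (corner R e))"
    using bij_betw_finite[OF bij_betw_points] fin by simp
  then show fin': "finite (carrier (corner R e))" by (rule finite_imageD) simp
  \<comment> \<open>The summand one is the point at infinity.\<close>
  show "card (max_left_ideals R) = card (carrier (corner R e)) + 1"
    using bij_betw_same_card[OF bij_betw_points] fin' by (simp add: card_image)
  show field: "field (corner R e)"
    using division_ring.finite_division_ring_is_field[OF division_ring_corner fin'] .
  show "primepow (card (carrier (corner R e)))"
    using field.primepow_card_finite_field[OF field fin'] .
qed

theorem theorem4:
  fixes R :: "('a, 'm) ring_scheme" and n :: nat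
  assumes "ring R"
    and "\<exists>M \<in> max_left_ideals R. \<exists>N \<in> max_left_ideals R. M \<noteq> N"
    and "n > 0"
    and "complete_multipartite n (nonunit_nonradical_comaximal_graph R)"
  shows "(n = 2 \<or> (\<exists>q. primepow q \<and> n = q + 1)) \<and>
    ((\<exists>q. primepow q \<and> n = q + 1 \<and>
        (\<exists>F :: 'a set ring. field F \<and> finite (carrier F) \<and> card (carrier F) = q \<and>
          R Quot (jacobson_radical R) \<simeq> matrix_ring 2 F)) \<or>
     (\<exists>(D1 :: 'a set ring) (D2 :: 'a set ring). division_ring D1 \<and> division_ring D2 \<and>
        R Quot (jacobson_radical R) \<simeq> RDirProd D1 D2))"
proof -
  let ?J = "jacobson_radical R" and ?S = "R Quot (jacobson_radical R)"
  obtain M N where M: "maximal_left_ideal M R" and N: "maximal_left_ideal N R" and MN: "M \<noteq> N"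
    using assms(2) by (auto simp: max_left_ideals_def)
  obtain P where P: "partition_on (carrier R - Units R - ?J) P" "finite P" "card P = n"
    and indep: "\<forall>A\<in>P. \<forall>u\<in>A. \<forall>v\<in>A. \<not> dominates (nonunit_nonradical_comaximal_graph R) u v"
    and compl: "\<forall>A\<in>P. \<forall>u\<in>A. \<forall>v\<in>(carrier R - Units R - ?J) - A.
      dominates (nonunit_nonradical_comaximal_graph R) u v"
    using assms(4) unfolding complete_multipartite_def verts_nonunit_nonradical_comaximal_graph
    by blast
  have sub: "u \<in> carrier R - Units R - ?J" if "A \<in> P" "u \<in> A" for A u
    using P(1) that unfolding partition_on_def by blast
  interpret complete_multipartite_comaximal R P
  proof (intro complete_multipartite_comaximal.intro complete_multipartite_comaximal_axioms.intro assms(1) P)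
    fix A u v assume A: "A \<in> P" "u \<in> A"
    show "PIdl\<^bsub>R\<^esub> u <+>\<^bsub>R\<^esub> PIdl\<^bsub>R\<^esub> v \<noteq> carrier R" if "v \<in> A" "u \<noteq> v"
      using indep A that sub unfolding dominates_nonunit_nonradical_comaximal_graph by blast
    show "PIdl\<^bsub>R\<^esub> u <+>\<^bsub>R\<^esub> PIdl\<^bsub>R\<^esub> v = carrier R" if "v \<in> carrier R - Units R - ?J" "v \<notin> A"
      using compl A that unfolding dominates_nonunit_nonradical_comaximal_graph by blast
  qed (use M N MN in blast)
  interpret J: ideal ?J R by (rule ideal_jacobson_radical)
  define h where "h = (+>\<^bsub>R\<^esub>) ?J"
  interpret h: ring_hom_ring R ?S h unfolding h_def by (rule J.rcos_ring_hom_ring)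
  have surj: "h ` carrier R = carrier ?S"
    by (auto simp: h_def FactRing_def A_RCOSETS_def' a_r_coset_def')
  have kerI: "x \<in> ?J \<longleftrightarrow> h x = \<zero>\<^bsub>?S\<^esub>" if "x \<in> carrier R" for x
    using that J.rcos_const_imp_mem a_rcos_zero[OF J.ideal_axioms] by (auto simp: h_def FactRing_def)
  have ker: "a_kernel R ?S h = ?J"
    using kerI J.a_subset unfolding a_kernel_def' by blast
  have bij: "bij_betw ((`) h) (max_left_ideals R) (max_left_ideals ?S)"
    using surj by (rule h.bij_betw_max_left_ideals) (auto simp: ker dest: mem_jacobson_radicalD)
  have fin: "finite (max_left_ideals ?S)"
    using bij_betw_finite[OF bij] bij_betw_finite[OF bij_betw_max_left_ideals_P] P(2) by simp
  have card: "card (max_left_ideals ?S) = n"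
    using bij_betw_same_card[OF bij] bij_betw_same_card[OF bij_betw_max_left_ideals_P] P(3) by simp
  have max: "maximal_left_ideal (h ` L) ?S" if "maximal_left_ideal L R" for L
    using bij_betwE[OF bij] that by (auto simp: max_left_ideals_def)
  have ne: "h ` M \<noteq> h ` N"
    using bij_betw_imp_inj_on[OF bij] M N MN by (auto simp: max_left_ideals_def inj_on_def)
  interpret N: maximal_left_ideal N R by fact
  \<comment> \<open>Images need not commute with intersections. Here elements \<open>m\<close> of
    \<open>M\<close> and \<open>k\<close> of \<open>N\<close> with the same image differ by an
    element of the radical, which lies in \<open>N\<close>, so \<open>m\<close> lies in both
    ideals.\<close>
  have "h ` M \<inter> h ` N \<subseteq> {\<zero>\<^bsub>?S\<^esub>}"
  proof
    fix x assume "x \<in> h ` M \<inter> h ` N"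
    then obtain m k where mk: "m \<in> M" "k \<in> N" "x = h m" "x = h k" by blast
    have c: "m \<in> carrier R" "k \<in> carrier R"
      using mk additive_subgroup.a_subset[OF left_ideal.axioms(1)[OF maximal_left_ideal.axioms(1)[OF M]]]
      by auto
    have "h (m \<ominus>\<^bsub>R\<^esub> k) = h m \<oplus>\<^bsub>?S\<^esub> (\<ominus>\<^bsub>?S\<^esub> h k)" using c by (simp add: minus_eq)
    also have "\<dots> = \<zero>\<^bsub>?S\<^esub>" using c mk(3,4) h.S.r_neg[of "h k"] by simp
    finally have "m \<ominus>\<^bsub>R\<^esub> k \<in> ?J" using kerI[OF minus_closed[OF c]] by simp
    then have "(m \<ominus>\<^bsub>R\<^esub> k) \<oplus>\<^bsub>R\<^esub> k \<in> N"
      by (intro N.a_closed mem_jacobson_radicalD[OF _ N] mk(2))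
    moreover have "(m \<ominus>\<^bsub>R\<^esub> k) \<oplus>\<^bsub>R\<^esub> k = m" using c by (simp add: minus_eq a_assoc l_neg)
    ultimately have "m \<in> N" by (simp only:)
    then have "m \<in> ?J" using mk(1) maximal_Int_maximal[OF M N MN] by blast
    then show "x \<in> {\<zero>\<^bsub>?S\<^esub>}" using kerI[OF c(1)] unfolding mk(3) by blast
  qed
  moreover have "\<zero>\<^bsub>?S\<^esub> \<in> h ` L" if "maximal_left_ideal L R" for L
    using additive_subgroup.zero_closed[OF left_ideal.axioms(1)[OF maximal_left_ideal.axioms(1)[OF max[OF that]]]] .
  ultimately have Int: "h ` M \<inter> h ` N = {\<zero>\<^bsub>?S\<^esub>}" using M N by blast
  obtain e f where ef: "two_simple_idempotents ?S e f"
    by (rule h.S.two_simple_idempotents_if_maximal_Int_zero[OF max[OF M] max[OF N] ne Int])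
  interpret ef: two_simple_idempotents ?S e f by (rule ef)
  interpret fe: two_simple_idempotents ?S f e by (rule ef.swap)
  show ?thesis
  proof (cases "(\<forall>x\<in>carrier ?S. e \<otimes>\<^bsub>?S\<^esub> (x \<otimes>\<^bsub>?S\<^esub> f) = \<zero>\<^bsub>?S\<^esub>) \<and>
      (\<forall>x\<in>carrier ?S. f \<otimes>\<^bsub>?S\<^esub> (x \<otimes>\<^bsub>?S\<^esub> e) = \<zero>\<^bsub>?S\<^esub>)")
    case True
    interpret decomposed ?S e f
      using True by unfold_locales auto
    have "n = 2" using card_max_left_ideals card by simp
    then show ?thesis
      using iso_RDirProd ef.division_ring_corner fe.division_ring_corner by blast
  next
    case False
    \<comment> \<open>One nonzero off-diagonal component suffices: \<open>(g, g')\<close> is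
      \<open>(e, f)\<close> or, when the nonzero component is \<open>fSe\<close>, the swapped
      pair.\<close>
    then obtain g g' a b where "matrix_units ?S g g' a b"
      using ef.matrix_units_if_nonzero fe.matrix_units_if_nonzero by metis
    then interpret u: matrix_units ?S g g' a b .
    show ?thesis
      using u.finite_corner_field[OF fin] u.iso_matrix_ring card by metis
  qed
qed

end
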